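(* Let $0<\alpha\le\gamma$. Let $\ket{\Psi}_{AB}$ be a bipartite pure state and let an arbitrary SLOCC protocol transform it into $\{p_m,\ket{\Psi_m}_{AB}\}$. Then $$E_\alpha(\Psi)\ge\left(\frac{\alpha}{1-\alpha}\right)\log\left[\sum_mp_m\,e^{\left(\frac{1-\alpha}{\alpha}\right)E_\gamma(\Psi_m)}\right],$$ where for $\alpha=1$ the right-hand side is understood as its limit $\sum_mp_mE_\gamma(\Psi_m)$ as $\alpha\to1$ in the prefactor and exponent.
   Context: All Hilbert spaces are finite-dimensional; $\log$ is the natural logarithm. For a unit vector $\ket{\Psi}_{AB}\in\mathcal H_A\otimes\mathcal H_B$ put $\rho_B=\mathrm{Tr}_A\ket{\Psi}\bra{\Psi}$. For $\alpha>0$, $\alpha\ne1$, the Rényi entanglement entropy (REE) is $E_\alpha(\Psi)=\frac{1}{1-\alpha}\log\mathrm{Tr}[\rho_B^\alpha]$; for $\alpha=1$, $E_1(\Psi)=E_S(\Psi)=-\mathrm{Tr}[\rho_B\log\rho_B]$ (the limit $\alpha\to1$). SLOCC protocol on pure states: a finite number of rounds; in each round one of the two parties (chosen depending on previous outcomes) applies a local measurement, i.e. a finite family of Kraus operators $\{K_j\}$ on its own system (possibly with a different finite-dimensional output space) with $\sum_jK_j^\dagger K_j=\mathbb 1$, which may depend on all previously obtained (classically communicated) outcomes. A sequence $m$ of outcomes corresponds to a product operator $A_m\otimes B_m$; it occurs with probability $p_m=\|(A_m\otimes B_m)\ket{\Psi}\|^2$, and (if $p_m>0$) the outcome state is $\ket{\Psi_m}=(A_m\otimes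 B_m)\ket{\Psi}/\sqrt{p_m}$. Thus $\sum_mp_m=1$, and one writes $\ket{\Psi}\to\{p_m,\ket{\Psi_m}\}$ (outcomes with $p_m=0$ are discarded). *)

theory Defs
  imports Complex_Main "Jordan_Normal_Form.Schur_Decomposition"
begin

definition mat_trace :: "complex mat \<Rightarrow> complex" where
  "mat_trace A = (\<Sum>i<dim_row A. A $$ (i, i))"

definition unitary_mat :: "nat \<Rightarrow> complex mat \<Rightarrow> bool" where
  "unitary_mat n U \<longleftrightarrow> U \<in> carrier_mat n n \<and>
     U * mat_adjoint U = 1\<^sub>m n \<and> mat_adjoint U * U = 1\<^sub>m n"

definition real_diag :: "nat \<Rightarrow> (nat \<Rightarrow> real) \<Rightarrow> complex mat" where
  "real_diag n d = mat_diag n (\<lambda>i. complex_of_real (d i))"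

(* Functional calculus of a Hermitian matrix: f(A) = U f(D) U^* for a unitary diagonalisation
   A = U D U^*.  The choice is harmless, since the value does not depend on the diagonalisation
   (lemma herm_fun_unique). *)
definition herm_fun_rel :: "(real \<Rightarrow> real) \<Rightarrow> complex mat \<Rightarrow> complex mat \<Rightarrow> bool" where
  "herm_fun_rel f A X \<longleftrightarrow> (\<exists>U d. unitary_mat (dim_row A) U \<and>
     A = U * real_diag (dim_row A) d * mat_adjoint U \<and>
     X = U * real_diag (dim_row A) (\<lambda>i. f (d i)) * mat_adjoint U)"

lemma herm_fun_unique:
  assumes "herm_fun_rel f A X" and "herm_fun_rel f A Y"
  shows "X = Y"
proof -
  define n where "n = dim_row A"
  obtain U d where U: "U \<in> carrier_mat n n" and U1: "U * mat_adjoint U = 1\<^sub>m n"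
    and U2: "mat_adjoint U * U = 1\<^sub>m n"
    and AU: "A = U * real_diag n d * mat_adjoint U"
    and X: "X = U * real_diag n (\<lambda>i. f (d i)) * mat_adjoint U"
    using assms(1) unfolding herm_fun_rel_def unitary_mat_def n_def by auto
  obtain V e where V: "V \<in> carrier_mat n n" and V1: "V * mat_adjoint V = 1\<^sub>m n"
    and V2: "mat_adjoint V * V = 1\<^sub>m n"
    and AV: "A = V * real_diag n e * mat_adjoint V"
    and Y: "Y = V * real_diag n (\<lambda>i. f (e i)) * mat_adjoint V"
    using assms(2) unfolding herm_fun_rel_def unitary_mat_def n_def by auto
  have carrier: "mat_adjoint M \<in> carrier_mat n n" if "M \<in> carrier_mat n n" for M :: "complex mat"
    using that unfolding mat_adjoint_def by (auto simp: mat_of_rows_def)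
  define U' V' where "U' = mat_adjoint U" and "V' = mat_adjoint V"
  have U': "U' \<in> carrier_mat n n" and V': "V' \<in> carrier_mat n n"
    using U V carrier by (auto simp: U'_def V'_def)
  have D: "real_diag n g \<in> carrier_mat n n" for g by (simp add: real_diag_def)
  note assoc = assoc_mult_mat[of _ n n _ n _ n]
  have move: "V' * (U * G * U') * U = (V' * U) * G" "V' * (V * G * V') * U = G * (V' * U)"
    if G: "G \<in> carrier_mat n n" for G
  proof -
    have "V' * (U * G * U') * U = V' * (U * (G * (U' * U)))"
      using U U' V' G by (simp add: assoc)
    also have "\<dots> = (V' * U) * G" using U V' G U2 by (simp add: assoc U'_def[symmetric])
    finally show "V' * (U * G * U') * U = (V' * U) * G" .
    have "V' * (V * G * V') * U = (V' * V) * (G * (V' * U))"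
      using U V V' G by (simp add: assoc)
    also have "\<dots> = G * (V' * U)"
      using U V' G V2 by (simp add: V'_def[symmetric])
    finally show "V' * (V * G * V') * U = G * (V' * U)" .
  qed
  define W where "W = V' * U"
  have W: "W \<in> carrier_mat n n" using V' U by (simp add: W_def)
  have WD: "W * real_diag n d = real_diag n e * W"
    using move(1)[OF D[of d]] move(2)[OF D[of e]] AU AV
    by (simp add: W_def U'_def V'_def)
  have entry: "W $$ (i, j) * complex_of_real (d j) = complex_of_real (e i) * W $$ (i, j)"
    if "i < n" "j < n" for i j
    using arg_cong[OF WD, of "\<lambda>M. M $$ (i, j)"] that
    by (simp add: real_diag_def mat_diag_mult_left[OF W] mat_diag_mult_right[OF W])
  have "W $$ (i, j) * complex_of_real (f (d j)) = complex_of_real (f (e i)) * W $$ (i, j)"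
    if "i < n" "j < n" for i j
    using entry[OF that] by (cases "W $$ (i, j) = 0") auto
  then have WF: "W * real_diag n (\<lambda>i. f (d i)) = real_diag n (\<lambda>i. f (e i)) * W"
    by (auto simp: real_diag_def mat_diag_mult_left[OF W] mat_diag_mult_right[OF W])
  have XY: "V' * X * U = V' * Y * U"
    using move(1)[OF D[of "\<lambda>i. f (d i)"]] move(2)[OF D[of "\<lambda>i. f (e i)"]] WF X Y
    by (simp add: W_def U'_def V'_def)
  have cancel: "V * (V' * Z * U) * U' = Z" if Z: "Z \<in> carrier_mat n n" for Z
  proof -
    have "V * (V' * Z * U) * U' = (V * V') * (Z * (U * U'))"
      using U U' V V' Z by (simp add: assoc)
    then show ?thesis using U1 V1 Z by (simp add: U'_def V'_def)
  qed
  have "X \<in> carrier_mat n n" "Y \<in> carrier_mat n n"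
    using X Y U V U' V' D by (auto simp: U'_def V'_def)
  then show ?thesis using cancel XY by metis
qed

definition herm_fun :: "(real \<Rightarrow> real) \<Rightarrow> complex mat \<Rightarrow> complex mat" where
  "herm_fun f A = (SOME X. herm_fun_rel f A X)"

(* The space C^a (x) C^b is C^(a*b), with |i>|j> the basis vector number i*b + j. *)
definition kron :: "complex mat \<Rightarrow> complex mat \<Rightarrow> complex mat" where
  "kron A B = mat (dim_row A * dim_row B) (dim_col A * dim_col B)
     (\<lambda>(r, c). A $$ (r div dim_row B, c div dim_col B) * B $$ (r mod dim_row B, c mod dim_col B))"

definition projector :: "complex vec \<Rightarrow> complex mat" where
  "projector \<psi> = mat (dim_vec \<psi>) (dim_vec \<psi>) (\<lambda>(r, c). \<psi> $ r * cnj (\<psi> $ c))"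

definition partial_trace_A :: "nat \<Rightarrow> nat \<Rightarrow> complex mat \<Rightarrow> complex mat" where
  "partial_trace_A a b X = mat b b (\<lambda>(j, l). \<Sum>i<a. X $$ (i * b + j, i * b + l))"

definition reduced_B :: "nat \<Rightarrow> nat \<Rightarrow> complex vec \<Rightarrow> complex mat" where
  "reduced_B a b \<psi> = partial_trace_A a b (projector \<psi>)"

(* The conventions 0 powr \<alpha> = 0 and ln 0 = 0 give zero eigenvalues the usual contribution 0. *)
definition renyi_entropy :: "real \<Rightarrow> nat \<Rightarrow> nat \<Rightarrow> complex vec \<Rightarrow> real" where
  "renyi_entropy \<alpha> a b \<psi> =
     (if \<alpha> = 1 then - Re (mat_trace (reduced_B a b \<psi> * herm_fun ln (reduced_B a b \<psi>)))
      else 1 / (1 - \<alpha>) * ln (Re (mat_trace (herm_fun (\<lambda>x. x powr \<alpha>) (reduced_B a b \<psi>)))))"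

(* A finite protocol tree: each node is a measurement by one party, given as the list of its
   Kraus operators, each paired with the protocol that is run after that outcome. *)
datatype protocol =
    Stop
  | Measure_A "(complex mat \<times> protocol) list"
  | Measure_B "(complex mat \<times> protocol) list"

(* sum_j K_j^* K_j = 1 on C^n, entrywise; the output space of K_j is C^(dim_row K_j). *)
definition kraus_family :: "nat \<Rightarrow> complex mat list \<Rightarrow> bool" where
  "kraus_family n Ks \<longleftrightarrow> (\<forall>K \<in> set Ks. dim_col K = n) \<and>
     foldr (\<lambda>K S. mat_adjoint K * K + S) Ks (0\<^sub>m n n) = 1\<^sub>m n"

inductive slocc_protocol :: "nat \<Rightarrow> nat \<Rightarrow> protocol \<Rightarrow> bool" where
  Stop: "slocc_protocol a b Stop"
| Measure_A: "kraus_family a (map fst Ks) \<Longrightarrow>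
    (\<And>K P. (K, P) \<in> set Ks \<Longrightarrow> slocc_protocol (dim_row K) b P) \<Longrightarrow>
    slocc_protocol a b (Measure_A Ks)"
| Measure_B: "kraus_family b (map fst Ks) \<Longrightarrow>
    (\<And>K P. (K, P) \<in> set Ks \<Longrightarrow> slocc_protocol a (dim_row K) P) \<Longrightarrow>
    slocc_protocol a b (Measure_B Ks)"

(* The pairs (A_m, B_m), one list entry for each complete outcome sequence m. *)
fun branches :: "nat \<Rightarrow> nat \<Rightarrow> protocol \<Rightarrow> (complex mat \<times> complex mat) list" where
  "branches a b Stop = [(1\<^sub>m a, 1\<^sub>m b)]"
| "branches a b (Measure_A Ks) =
     concat (map (\<lambda>(K, P). map (\<lambda>(A, B). (A * K, B)) (branches (dim_row K) b P)) Ks)"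
| "branches a b (Measure_B Ks) =
     concat (map (\<lambda>(K, P). map (\<lambda>(A, B). (A, B * K)) (branches a (dim_row K) P)) Ks)"

definition outcome_prob :: "complex mat \<Rightarrow> complex mat \<Rightarrow> complex vec \<Rightarrow> real" where
  "outcome_prob A B \<psi> = (let \<phi> = kron A B *\<^sub>v \<psi> in Re (\<phi> \<bullet>c \<phi>))"

definition outcome_state :: "complex mat \<Rightarrow> complex mat \<Rightarrow> complex vec \<Rightarrow> complex vec" where
  "outcome_state A B \<psi> =
     complex_of_real (1 / sqrt (outcome_prob A B \<psi>)) \<cdot>\<^sub>v (kron A B *\<^sub>v \<psi>)"

(* Entries (p_m, a_m, b_m, \<Psi>_m) with \<Psi>_m a state on C^a_m (x) C^b_m; outcomes of
   probability 0 are discarded. *)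
definition outcomes :: "nat \<Rightarrow> nat \<Rightarrow> protocol \<Rightarrow> complex vec \<Rightarrow>
    (real \<times> nat \<times> nat \<times> complex vec) list" where
  "outcomes a b P \<psi> =
     map (\<lambda>(A, B). (outcome_prob A B \<psi>, dim_row A, dim_row B, outcome_state A B \<psi>))
       (filter (\<lambda>(A, B). outcome_prob A B \<psi> > 0) (branches a b P))"

end

theory Submission
  imports Defs "Jordan_Normal_Form.Spectral_Radius"
begin

text \<open>
  Write \<open>\<psi>\<close> as its coefficient matrix N, so that \<open>\<rho>\<^sub>B = N N\<^sup>*\<close> and a branch \<open>(A, B)\<close> acts as
  \<open>N \<mapsto> B N A\<^sup>T\<close>.  For \<open>\<alpha> \<noteq> 1\<close> put \<open>F(\<rho>) = sgn (1 - \<alpha>) (Tr \<rho>\<^sup>\<alpha>)\<^sup>1\<^sup>/\<^sup>\<alpha>\<close>, and for \<open>\<alpha> = 1\<close> put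
  \<open>F(\<rho>) = - Tr (\<rho> log \<rho>) + Tr \<rho> log (Tr \<rho>)\<close>; the theorem for \<open>\<gamma> = \<alpha>\<close> says that the sum of F over the
  unnormalised outcomes is at most its initial value, and larger \<open>\<gamma>\<close> only decreases the outcome
  entropies.  It suffices to treat one measurement.  A measurement by A decomposes \<open>\<rho>\<^sub>B\<close> as the sum of
  the outcome operators: in an eigenbasis of \<open>\<rho>\<^sub>B\<close> the diagonals of the outcomes add up to the spectrum
  of \<open>\<rho>\<^sub>B\<close>, F does not decrease when a spectrum is replaced by a diagonal (Jensen), and F is
  superadditive on vectors (Minkowski).  For a measurement by B write \<open>\<rho>\<^sub>B = Z Z\<^sup>*\<close> with \<open>Z = U D\<^sup>1\<^sup>/\<^sup>2\<close>;
  now the squared column norms of \<open>K Z\<close> add up to the spectrum of \<open>\<rho>\<^sub>B\<close>, and they again dominate the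
  spectrum of \<open>K \<rho>\<^sub>B K\<^sup>* = (K Z) (K Z)\<^sup>*\<close> under F.
\<close>

section \<open>Superadditive entropy functionals\<close>

text \<open>Weighted AM-GM: \<open>ln x \<le> x - 1\<close> is used at \<open>r / A\<close> and
  \<open>1 / A\<close> with weights \<alpha> and 1 - \<alpha>, where \<open>A\<close> is the value
  of the tangent; the upper bounds then add up to 0.\<close>

lemma powr_tangent_le:
  fixes \<alpha> r :: real
  assumes "0 < \<alpha>" "\<alpha> \<le> 1" "0 \<le> r"
  shows "r powr \<alpha> \<le> 1 + \<alpha> * (r - 1)"
proof (cases "r = 0")
  case False
  then have r: "r > 0" using assms by simp
  define A where "A = 1 + \<alpha> * (r - 1)"
  have "\<alpha> * r > 0" using r assms by simp
  then have A: "A > 0" using assms unfolding A_def by (simp add: algebra_simps)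
  have "\<alpha> * ln (r / A) + (1 - \<alpha>) * ln (1 / A) \<le> \<alpha> * (r / A - 1) + (1 - \<alpha>) * (1 / A - 1)"
    using assms r A by (intro add_mono mult_left_mono ln_le_minus_one) auto
  also have "\<dots> = (1 + \<alpha> * (r - 1)) / A - 1" using A by (simp add: field_simps)
  also have "\<dots> = 0" using A unfolding A_def[symmetric] by simp
  finally have "\<alpha> * ln r \<le> ln A" using r A by (simp add: ln_div algebra_simps)
  then have "exp (\<alpha> * ln r) \<le> A" using A by (metis exp_le_cancel_iff exp_ln)
  then show ?thesis using r unfolding A_def powr_def by simp
qed (use assms in auto)

text \<open>The previous bound for the exponent \<open>1 / \<alpha>\<close>, taken at the value
  \<open>s\<close> of the tangent and raised to the power \<alpha>.\<close>

lemma powr_tangent_ge: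
  fixes \<alpha> r :: real
  assumes "1 \<le> \<alpha>" "0 \<le> r"
  shows "1 + \<alpha> * (r - 1) \<le> r powr \<alpha>"
proof (cases "1 + \<alpha> * (r - 1) \<le> 0")
  case False
  define s where "s = 1 + \<alpha> * (r - 1)"
  have s: "s > 0" using False by (simp add: s_def)
  have "s powr (1 / \<alpha>) \<le> 1 + 1 / \<alpha> * (s - 1)" using assms s by (intro powr_tangent_le) auto
  also have "\<dots> = r" using assms by (simp add: s_def field_simps)
  finally have "(s powr (1 / \<alpha>)) powr \<alpha> \<le> r powr \<alpha>" using assms by (intro powr_mono2) auto
  then show ?thesis using assms s by (simp add: powr_powr s_def)
qed (use powr_ge_zero[of r \<alpha>] in linarith)

text \<open>The sign makes the kernel concave for every positive order, although
  \<open>x powr \<alpha>\<close> is convex for \<alpha> > 1; one Jensen inequality then serves all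
  orders.\<close>

definition entropy_kernel :: "real \<Rightarrow> real \<Rightarrow> real" where
  "entropy_kernel \<alpha> x = (if \<alpha> = 1 then - x * ln x else sgn (1 - \<alpha>) * x powr \<alpha>)"

lemma entropy_kernel_0 [simp]: "entropy_kernel \<alpha> 0 = 0"
  by (simp add: entropy_kernel_def)

text \<open>Concavity in the form of a supporting line. The point of contact is positive because the
  kernel has infinite slope at 0 when \<alpha> \<le> 1.\<close>

lemma entropy_kernel_tangent:
  assumes "0 < \<alpha>" "0 < x"
  obtains c where "\<And>y. 0 \<le> y \<Longrightarrow> entropy_kernel \<alpha> y \<le> entropy_kernel \<alpha> x + c * (y - x)"
proof -
  have "entropy_kernel \<alpha> y \<le> entropy_kernel \<alpha> x + (if \<alpha> = 1 then - ln x - 1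
          else sgn (1 - \<alpha>) * (x powr \<alpha> * \<alpha> / x)) * (y - x)"
    if y: "0 \<le> y" for y
  proof (cases "\<alpha> = 1")
    case True
    show ?thesis
    proof (cases "y = 0")
      case False
      then have "y * ln (x / y) \<le> y * (x / y - 1)"
        using y assms by (intro mult_left_mono ln_le_minus_one) auto
      then show ?thesis using True False y assms by (simp add: entropy_kernel_def ln_div algebra_simps)
    qed (use True assms in \<open>simp add: entropy_kernel_def algebra_simps\<close>)
  next
    case False
    have y': "y powr \<alpha> = x powr \<alpha> * (y / x) powr \<alpha>"
      using assms y by (simp add: powr_divide)
    have e: "x powr \<alpha> * (1 + \<alpha> * (y / x - 1)) = x powr \<alpha> + x powr \<alpha> * \<alpha> / x * (y - x)"
      using assms by (simp add: field_simps)
    show ?thesis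
    proof (cases "\<alpha> < 1")
      case True
      have "x powr \<alpha> * (y / x) powr \<alpha> \<le> x powr \<alpha> * (1 + \<alpha> * (y / x - 1))"
        using assms y True by (intro mult_left_mono powr_tangent_le) auto
      then show ?thesis using True unfolding entropy_kernel_def y' e by simp
    next
      case f: False
      have "x powr \<alpha> * (1 + \<alpha> * (y / x - 1)) \<le> x powr \<alpha> * (y / x) powr \<alpha>"
        using assms y f by (intro mult_left_mono powr_tangent_ge) auto
      then show ?thesis using f False unfolding entropy_kernel_def y' e by simp
    qed
  qed
  then show ?thesis using that by blast
qed

text \<open>Since the kernel vanishes at 0, Jensen's inequality also holds for weights of total mass below 1.\<close>

lemma entropy_kernel_jensen:
  assumes \<alpha>: "0 < \<alpha>" and fin: "finite I"
    and w: "\<And>i. i \<in> I \<Longrightarrow> 0 \<le> w i" and w1: "sum w I \<le> 1"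
    and y: "\<And>i. i \<in> I \<Longrightarrow> 0 \<le> y i"
  shows "(\<Sum>i\<in>I. w i * entropy_kernel \<alpha> (y i)) \<le> entropy_kernel \<alpha> (\<Sum>i\<in>I. w i * y i)"
proof (cases "(\<Sum>i\<in>I. w i * y i) = 0")
  case True
  then have "w i * y i = 0" if "i \<in> I" for i
    using sum_nonneg_eq_0_iff[OF fin, of "\<lambda>i. w i * y i"] w y that by auto
  then have "w i * entropy_kernel \<alpha> (y i) = 0" if "i \<in> I" for i using that by fastforce
  then show ?thesis by (simp add: True)
next
  case False
  define x where "x = (\<Sum>i\<in>I. w i * y i)"
  have "x \<ge> 0" unfolding x_def using w y by (intro sum_nonneg) auto
  then have x: "x > 0" using False x_def by simp
  obtain c where c: "\<And>y. 0 \<le> y \<Longrightarrow> entropy_kernel \<alpha> y \<le> entropy_kernel \<alpha> x + c * (y - x)"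
    using entropy_kernel_tangent[OF \<alpha> x] by blast
  have "(\<Sum>i\<in>I. w i * entropy_kernel \<alpha> (y i)) \<le> (\<Sum>i\<in>I. w i * (entropy_kernel \<alpha> x + c * (y i - x)))"
    using w y c by (intro sum_mono mult_left_mono) auto
  also have "\<dots> = (\<Sum>i\<in>I. w i * (entropy_kernel \<alpha> x - c * x) + c * (w i * y i))"
    by (simp add: algebra_simps)
  also have "\<dots> = sum w I * (entropy_kernel \<alpha> x - c * x) + c * x"
    unfolding sum.distrib x_def by (simp add: sum_distrib_left sum_distrib_right)
  \<comment> \<open>At 0 the supporting line says that its intercept
    \<open>entropy_kernel \<alpha> x - c * x\<close> is nonnegative, so raising the mass to 1 cannot
    decrease the sum.\<close>
  also have "\<dots> \<le> 1 * (entropy_kernel \<alpha> x - c * x) + c * x"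
    using w1 c[of 0] x by (intro add_mono mult_right_mono) auto
  finally show ?thesis by (simp add: x_def)
qed

text \<open>The extension, homogeneous of degree 1, of \<open>exp ((1 - \<alpha>) / \<alpha> * E\<^sub>\<alpha>)\<close> (of \<open>E\<^sub>1\<close> itself for
  \<open>\<alpha> = 1\<close>) from probability vectors to nonnegative vectors.  The sign makes it superadditive also
  for \<open>\<alpha> > 1\<close>, where the Schatten norm is subadditive.\<close>

definition scaled_entropy :: "real \<Rightarrow> nat \<Rightarrow> (nat \<Rightarrow> real) \<Rightarrow> real" where
  "scaled_entropy \<alpha> n x = (if \<alpha> = 1 then (\<Sum>i<n. - x i * ln (x i)) + (\<Sum>i<n. x i) * ln (\<Sum>i<n. x i)
     else sgn (1 - \<alpha>) * (\<Sum>i<n. x i powr \<alpha>) powr (1 / \<alpha>))"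

lemma scaled_entropy_zero: "(\<And>i. i < n \<Longrightarrow> x i = 0) \<Longrightarrow> scaled_entropy \<alpha> n x = 0"
  by (simp add: scaled_entropy_def)

lemma scaled_entropy_cong: "(\<And>i. i < n \<Longrightarrow> x i = y i) \<Longrightarrow> scaled_entropy \<alpha> n x = scaled_entropy \<alpha> n y"
  by (simp add: scaled_entropy_def)

text \<open>The logarithm of the total mass absorbs the normalisation by \<open>X\<close>, so that
  concavity of the kernel can be used on probability vectors.\<close>

lemma scaled_entropy_one_scaled:
  assumes "(\<Sum>i<n. x i) = X" "X > 0" "\<And>i. i < n \<Longrightarrow> 0 \<le> x i"
  shows "scaled_entropy 1 n x = X * (\<Sum>i<n. entropy_kernel 1 (x i / X))"
proof -
  have "X * entropy_kernel 1 (x i / X) = - x i * ln (x i) + x i * ln X" if "i < n" for i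
    using assms(2) assms(3)[OF that] by (cases "x i = 0") (auto simp: entropy_kernel_def ln_div algebra_simps)
  then have "X * (\<Sum>i<n. entropy_kernel 1 (x i / X)) = (\<Sum>i<n. - x i * ln (x i) + x i * ln X)"
    by (simp add: sum_distrib_left)
  also have "\<dots> = (\<Sum>i<n. - x i * ln (x i)) + (\<Sum>i<n. x i) * ln X"
    by (simp add: sum.distrib sum_negf sum_subtractf sum_distrib_right)
  finally show ?thesis using assms(1) by (simp add: scaled_entropy_def)
qed

text \<open>Minkowski's argument: each vector is divided by its own size, and the normalised sum is
  the convex combination of the normalised vectors with weights \<open>X / (X + Y)\<close> and
  \<open>Y / (X + Y)\<close>, to which concavity of the kernel applies.\<close>

lemma scaled_entropy_superadd:
  assumes \<alpha>: "0 < \<alpha>" and x: "\<And>i. i < n \<Longrightarrow> 0 \<le> x i" and y: "\<And>i. i < n \<Longrightarrow> 0 \<le> y i"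
  shows "scaled_entropy \<alpha> n x + scaled_entropy \<alpha> n y \<le> scaled_entropy \<alpha> n (\<lambda>i. x i + y i)"
proof -
  have jensen: "X / (X + Y) * (\<Sum>i<n. entropy_kernel \<alpha> (x i / X)) + Y / (X + Y) * (\<Sum>i<n. entropy_kernel \<alpha> (y i / Y))
      \<le> (\<Sum>i<n. entropy_kernel \<alpha> ((x i + y i) / (X + Y)))" if X: "X > 0" and Y: "Y > 0" for X Y
  proof -
    have "X / (X + Y) * entropy_kernel \<alpha> (x i / X) + Y / (X + Y) * entropy_kernel \<alpha> (y i / Y)
        \<le> entropy_kernel \<alpha> ((x i + y i) / (X + Y))" if "i < n" for i
      using entropy_kernel_jensen[OF \<alpha>, of "{True, False}" "\<lambda>b. if b then X / (X + Y) else Y / (X + Y)"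
          "\<lambda>b. if b then x i / X else y i / Y"] X Y x[OF that] y[OF that]
      by (simp add: add_divide_distrib[symmetric])
    then show ?thesis
      unfolding sum_distrib_left sum.distrib[symmetric] by (intro sum_mono) auto
  qed
  \<comment> \<open>The size used for normalisation; it is 0 only for the zero vector, a case in
    which the claim is an equality.\<close>
  define Nf where "Nf z = (if \<alpha> = 1 then (\<Sum>i<n. z i) else (\<Sum>i<n. z i powr \<alpha>) powr (1 / \<alpha>))" for z :: "nat \<Rightarrow> real"
  have Nf0: "z i = 0" if z: "\<And>i. i < n \<Longrightarrow> 0 \<le> z i" and "Nf z \<le> 0" "i < n" for z i
  proof (cases "\<alpha> = 1")
    case True
    then have "(\<Sum>i<n. z i) = 0" using that(2) z by (auto simp: Nf_def intro!: order_antisym sum_nonneg)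
    then show ?thesis using z that(3) by (subst (asm) sum_nonneg_eq_0_iff) auto
  next
    case False
    have "(\<Sum>i<n. z i powr \<alpha>) powr (1 / \<alpha>) = 0" using that(2) False
      by (simp add: Nf_def)
    then have "(\<Sum>i<n. z i powr \<alpha>) = 0" by simp
    then show ?thesis using that(3) by (subst (asm) sum_nonneg_eq_0_iff) auto
  qed
  show ?thesis
  proof (cases "Nf x \<le> 0 \<or> Nf y \<le> 0")
    case True
    then show ?thesis
    proof
      assume "Nf x \<le> 0"
      then have "x i = 0" if "i < n" for i using Nf0[of x] x that by blast
      then show ?thesis using scaled_entropy_zero[of n x] scaled_entropy_cong[of n "\<lambda>i. x i + y i" y] by simp
    next
      assume "Nf y \<le> 0"
      then have "y i = 0" if "i < n" for i using Nf0[of y] y that by blast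
      then show ?thesis using scaled_entropy_zero[of n y] scaled_entropy_cong[of n "\<lambda>i. x i + y i" x] by simp
    qed
  next
    case False
    define X Y where "X = Nf x" and "Y = Nf y"
    have X: "X > 0" and Y: "Y > 0" using False by (auto simp: X_def Y_def)
    note j = jensen[OF X Y]
    show ?thesis
    proof (cases "\<alpha> = 1")
      case True
      have sX: "(\<Sum>i<n. x i) = X" "(\<Sum>i<n. y i) = Y" by (auto simp: X_def Y_def Nf_def True)
      have s: "(\<Sum>i<n. x i + y i) = X + Y" using sX by (simp add: sum.distrib)
      have "scaled_entropy 1 n x + scaled_entropy 1 n y = (X + Y) * (X / (X + Y) * (\<Sum>i<n. entropy_kernel 1 (x i / X)) +
          Y / (X + Y) * (\<Sum>i<n. entropy_kernel 1 (y i / Y)))"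
        using scaled_entropy_one_scaled[OF sX(1) X x] scaled_entropy_one_scaled[OF sX(2) Y y] X Y
        by (simp add: distrib_left)
      also have "\<dots> \<le> (X + Y) * (\<Sum>i<n. entropy_kernel 1 ((x i + y i) / (X + Y)))"
        using j X Y True by (intro mult_left_mono) auto
      also have "\<dots> = scaled_entropy 1 n (\<lambda>i. x i + y i)"
        using scaled_entropy_one_scaled[OF s] X Y x y by simp
      finally show ?thesis using True by simp
    next
      case \<alpha>1: False
      have P: "(\<Sum>i<n. (z i / Z) powr \<alpha>) = (\<Sum>i<n. z i powr \<alpha>) / Z powr \<alpha>"
        if "Z > 0" "\<And>i. i < n \<Longrightarrow> 0 \<le> z i" for z Z
        using that by (simp add: powr_divide sum_divide_distrib)
      have XP: "(\<Sum>i<n. x i powr \<alpha>) = X powr \<alpha>" "(\<Sum>i<n. y i powr \<alpha>) = Y powr \<alpha>"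
        using \<alpha> \<alpha>1 by (auto simp: X_def Y_def Nf_def powr_powr sum_nonneg)
      define Z where "Z = (\<Sum>i<n. (x i + y i) powr \<alpha>)"
      have Z0: "Z \<ge> 0" by (simp add: Z_def sum_nonneg)
      have "X / (X + Y) * sgn (1 - \<alpha>) + Y / (X + Y) * sgn (1 - \<alpha>)
          \<le> sgn (1 - \<alpha>) * (Z / (X + Y) powr \<alpha>)"
        using j P[OF X x] P[OF Y y] P[of "X + Y" "\<lambda>i. x i + y i"] X Y x y \<alpha>1
        by (simp add: entropy_kernel_def sum_distrib_left[symmetric] XP Z_def)
      moreover have "X / (X + Y) * sgn (1 - \<alpha>) + Y / (X + Y) * sgn (1 - \<alpha>) = sgn (1 - \<alpha>)"
        using X Y by (simp add: distrib_right[symmetric] add_divide_distrib[symmetric])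
      \<comment> \<open>By the choice of \<open>X\<close> and \<open>Y\<close> both normalised
        kernel sums equal \<open>sgn (1 - \<alpha>)\<close>, so Jensen compares \<alpha>-th powers;
        the root is then taken separately for the two signs.\<close>
      ultimately have m: "sgn (1 - \<alpha>) * (X + Y) powr \<alpha> \<le> sgn (1 - \<alpha>) * Z"
        using X Y by (simp add: pos_le_divide_eq)
      have r: "((X + Y) powr \<alpha>) powr (1 / \<alpha>) = X + Y" using X Y \<alpha> by (simp add: powr_powr)
      have "sgn (1 - \<alpha>) * (X + Y) \<le> sgn (1 - \<alpha>) * Z powr (1 / \<alpha>)"
      proof (cases "\<alpha> < 1")
        case True
        then have "((X + Y) powr \<alpha>) powr (1 / \<alpha>) \<le> Z powr (1 / \<alpha>)"
          using m \<alpha> by (intro powr_mono2) auto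
        then show ?thesis using True r by simp
      next
        case False
        then have "Z powr (1 / \<alpha>) \<le> ((X + Y) powr \<alpha>) powr (1 / \<alpha>)"
          using m \<alpha> \<alpha>1 Z0 by (intro powr_mono2) auto
        then show ?thesis using False \<alpha>1 r by simp
      qed
      then show ?thesis using \<alpha>1
        by (simp add: scaled_entropy_def Z_def[symmetric] X_def Y_def Nf_def distrib_left)
    qed
  qed
qed

lemma scaled_entropy_superadd_list:
  assumes \<alpha>: "0 < \<alpha>" and x: "\<And>K i. K \<in> set Ks \<Longrightarrow> i < n \<Longrightarrow> 0 \<le> x K i"
  shows "(\<Sum>K\<leftarrow>Ks. scaled_entropy \<alpha> n (x K)) \<le> scaled_entropy \<alpha> n (\<lambda>i. \<Sum>K\<leftarrow>Ks. x K i)"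
  using x
proof (induction Ks)
  case (Cons K Ks)
  have "scaled_entropy \<alpha> n (x K) + scaled_entropy \<alpha> n (\<lambda>i. \<Sum>K\<leftarrow>Ks. x K i)
      \<le> scaled_entropy \<alpha> n (\<lambda>i. x K i + (\<Sum>K\<leftarrow>Ks. x K i))"
    using Cons.prems by (intro scaled_entropy_superadd[OF \<alpha>] sum_list_nonneg) auto
  then show ?case using Cons by fastforce
qed (simp add: scaled_entropy_zero)

text \<open>Jensen is applied in each row, and the unit column sums on the support of \<mu> restore
  the totals. Row sums may stay below 1 because the weights obtained later from Bessel's inequality
  satisfy no more than that.\<close>

lemma scaled_entropy_substochastic:
  assumes \<alpha>: "0 < \<alpha>"
    and S: "\<And>k l. k < n \<Longrightarrow> l < m \<Longrightarrow> 0 \<le> S k l"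
    and row: "\<And>k. k < n \<Longrightarrow> (\<Sum>l<m. S k l) \<le> 1"
    and col: "\<And>l. l < m \<Longrightarrow> \<mu> l \<noteq> 0 \<Longrightarrow> (\<Sum>k<n. S k l) = 1"
    and \<mu>: "\<And>l. l < m \<Longrightarrow> 0 \<le> \<mu> l"
    and x: "\<And>k. k < n \<Longrightarrow> x k = (\<Sum>l<m. S k l * \<mu> l)"
  shows "scaled_entropy \<alpha> m \<mu> \<le> scaled_entropy \<alpha> n x"
proof -
  have swap: "(\<Sum>k<n. \<Sum>l<m. S k l * f (\<mu> l)) = (\<Sum>l<m. f (\<mu> l))"
    if "f 0 = 0" for f :: "real \<Rightarrow> real"
  proof -
    have "(\<Sum>k<n. \<Sum>l<m. S k l * f (\<mu> l)) = (\<Sum>l<m. (\<Sum>k<n. S k l) * f (\<mu> l))"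
      by (subst sum.swap) (simp add: sum_distrib_right)
    also have "\<dots> = (\<Sum>l<m. f (\<mu> l))"
    proof (intro sum.cong refl)
      fix l assume "l \<in> {..<m}"
      then show "(\<Sum>k<n. S k l) * f (\<mu> l) = f (\<mu> l)"
        using col[of l] that by (cases "\<mu> l = 0") auto
    qed
    finally show ?thesis .
  qed
  have "(\<Sum>l<m. entropy_kernel \<alpha> (\<mu> l)) = (\<Sum>k<n. \<Sum>l<m. S k l * entropy_kernel \<alpha> (\<mu> l))"
    by (simp add: swap)
  also have "\<dots> \<le> (\<Sum>k<n. entropy_kernel \<alpha> (x k))"
    using S row \<mu> x by (intro sum_mono) (auto intro!: entropy_kernel_jensen[OF \<alpha>])
  finally have e: "(\<Sum>l<m. entropy_kernel \<alpha> (\<mu> l)) \<le> (\<Sum>k<n. entropy_kernel \<alpha> (x k))" .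
  \<comment> \<open>The identity function vanishes at 0 as well, so the total mass is preserved;
    order 1 uses this for its logarithmic term.\<close>
  have t: "(\<Sum>k<n. x k) = (\<Sum>l<m. \<mu> l)" using swap[of "\<lambda>x. x"] x by simp
  show ?thesis
  proof (cases "\<alpha> = 1")
    case True
    then show ?thesis using e t by (simp add: scaled_entropy_def entropy_kernel_def)
  next
    case False
    have e': "sgn (1 - \<alpha>) * (\<Sum>l<m. \<mu> l powr \<alpha>) \<le> sgn (1 - \<alpha>) * (\<Sum>k<n. x k powr \<alpha>)"
      using e False by (simp add: entropy_kernel_def sum_distrib_left)
    show ?thesis
    proof (cases "\<alpha> < 1")
      case True
      then show ?thesis using e' \<alpha> False
        by (auto simp: scaled_entropy_def intro!: powr_mono2 sum_nonneg)
    next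
      case f: False
      then show ?thesis using e' \<alpha> False
        by (auto simp: scaled_entropy_def intro!: powr_mono2 sum_nonneg)
    qed
  qed
qed

section \<open>Unitary diagonalisation of Hermitian matrices\<close>

lemma dim_mat_adjoint [simp]: "dim_row (mat_adjoint A) = dim_col A" "dim_col (mat_adjoint A) = dim_row A"
  by (auto simp: mat_adjoint_def)

lemma mat_adjoint_carrier [simp]: "mat_adjoint A \<in> carrier_mat m n \<longleftrightarrow> A \<in> carrier_mat n m"
  unfolding carrier_mat_def by auto

lemma index_mat_adjoint [simp]:
  fixes A :: "complex mat"
  shows "i < dim_col A \<Longrightarrow> j < dim_row A \<Longrightarrow> mat_adjoint A $$ (i, j) = cnj (A $$ (j, i))"
  by (simp add: mat_adjoint_def mat_of_rows_index)

lemma index_mult_sum: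
  "i < dim_row A \<Longrightarrow> j < dim_col B \<Longrightarrow> dim_col A = dim_row B \<Longrightarrow>
   (A * B) $$ (i, j) = (\<Sum>k<dim_row B. A $$ (i, k) * B $$ (k, j))"
  by (simp add: scalar_prod_def lessThan_atLeast0)

lemma mult_mat_assoc:
  "dim_col A = dim_row B \<Longrightarrow> dim_col B = dim_row C \<Longrightarrow> A * B * C = A * (B * C)"
  by (rule assoc_mult_mat[of A "dim_row A" "dim_col A" B "dim_col B" C "dim_col C"])
    auto

lemma mat_adjoint_mult:
  fixes A B :: "complex mat"
  assumes "dim_col A = dim_row B"
  shows "mat_adjoint (A * B) = mat_adjoint B * mat_adjoint A"
proof (intro eq_matI)
  fix i j assume "i < dim_row (mat_adjoint B * mat_adjoint A)" "j < dim_col (mat_adjoint B * mat_adjoint A)"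
  then have ij: "i < dim_col B" "j < dim_row A" by auto
  have "mat_adjoint (A * B) $$ (i, j) = cnj (\<Sum>k<dim_row B. A $$ (j, k) * B $$ (k, i))"
    using ij assms by (simp add: index_mult_sum del: index_mult_mat(1))
  also have "\<dots> = (\<Sum>k<dim_row B. mat_adjoint B $$ (i, k) * mat_adjoint A $$ (k, j))"
    using ij assms by (simp add: mult.commute)
  also have "\<dots> = (mat_adjoint B * mat_adjoint A) $$ (i, j)"
    using ij assms by (simp add: index_mult_sum del: index_mult_mat(1))
  finally show "mat_adjoint (A * B) $$ (i, j) = (mat_adjoint B * mat_adjoint A) $$ (i, j)" .
qed simp_all

lemma mat_adjoint_adjoint [simp]: "mat_adjoint (mat_adjoint A) = (A :: complex mat)"
  by (intro eq_matI) auto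

lemma real_diag_carrier [simp]: "real_diag n d \<in> carrier_mat n n"
  by (simp add: real_diag_def)

lemma dim_real_diag [simp]: "dim_row (real_diag n d) = n" "dim_col (real_diag n d) = n"
  using real_diag_carrier[of n d] by (auto simp del: real_diag_carrier)

lemma index_real_diag [simp]:
  "i < n \<Longrightarrow> j < n \<Longrightarrow> real_diag n d $$ (i, j) = (if i = j then complex_of_real (d i) else 0)"
  by (simp add: real_diag_def mat_diag_def)

lemma unitary_matI:
  assumes "U \<in> carrier_mat n n" "mat_adjoint U * U = 1\<^sub>m n"
  shows "unitary_mat n U"
  using assms mat_mult_left_right_inverse[of "mat_adjoint U" n U] by (auto simp: unitary_mat_def)

lemma unitary_mat_cancel:
  assumes "unitary_mat n U" "dim_row X = n"
  shows "mat_adjoint U * (U * X) = X" "U * (mat_adjoint U * X) = X"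
proof -
  have U: "U \<in> carrier_mat n n" "mat_adjoint U * U = 1\<^sub>m n" "U * mat_adjoint U = 1\<^sub>m n"
    using assms by (auto simp: unitary_mat_def)
  have "mat_adjoint U * (U * X) = (mat_adjoint U * U) * X"
    using U(1) assms(2) by (intro mult_mat_assoc[symmetric]) auto
  then show "mat_adjoint U * (U * X) = X" using U(2) assms(2) by simp
  have "U * (mat_adjoint U * X) = (U * mat_adjoint U) * X"
    using U(1) assms(2) by (intro mult_mat_assoc[symmetric]) auto
  then show "U * (mat_adjoint U * X) = X" using U(3) assms(2) by simp
qed

lemma unitary_mat_mult:
  assumes U: "unitary_mat n U" and V: "unitary_mat n V"
  shows "unitary_mat n (U * V)"
proof (rule unitary_matI)
  have c: "U \<in> carrier_mat n n" "V \<in> carrier_mat n n" using U V by (auto simp: unitary_mat_def)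
  show "U * V \<in> carrier_mat n n" using c by simp
  have "mat_adjoint (U * V) * (U * V) = mat_adjoint V * ((mat_adjoint U * U) * V)"
    using c by (simp add: mat_adjoint_mult mult_mat_assoc)
  then show "mat_adjoint (U * V) * (U * V) = 1\<^sub>m n"
    using U V c by (simp add: unitary_mat_def mult_mat_assoc unitary_mat_cancel[OF U])
qed

text \<open>Gram-Schmidt on a basis that starts with \<open>v\<close>. Its output is orthogonal but
  not normalised, so each column is divided by its length; \<open>c\<close> is that factor for the
  first column.\<close>

lemma unitary_mat_first_column:
  assumes v: "v \<in> carrier_vec n" and v0: "v \<noteq> 0\<^sub>v n"
  obtains W c where "unitary_mat n W" "\<And>i. i < n \<Longrightarrow> W $$ (i, 0) = c * v $ i"
proof -
  interpret cof_vec_space n "TYPE(complex)" .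
  define b where "b = basis_completion v"
  define ws where "ws = gram_schmidt n b"
  have n: "n > 0" using v v0 by (cases n) auto
  from basis_completion[OF v v0, folded b_def]
  have dist_b: "distinct b"
    and indep: "\<not> lin_dep (set b)" and b: "set b \<subseteq> carrier_vec n" and hdb: "hd b = v"
    and len_b: "length b = n" by auto
  from hdb len_b n obtain vs where bv: "b = v # vs" by (cases b, auto)
  from gram_schmidt_result[OF b dist_b indep refl, folded ws_def]
  have ws: "set ws \<subseteq> carrier_vec n" "corthogonal ws" "length ws = n"
    by (auto simp: len_b)
  from gram_schmidt_hd[OF v, of vs, folded bv] have hdws: "hd ws = v" unfolding ws_def .
  then have ws0: "ws ! 0 = v" using n ws(3) by (cases ws) auto
  define s where "s j = (\<Sum>i<n. (cmod (ws ! j $ i))\<^sup>2)" for j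
  define W where "W = mat n n (\<lambda>(i, j). complex_of_real (1 / sqrt (s j)) * ws ! j $ i)"
  have W: "W \<in> carrier_mat n n" by (simp add: W_def)
  have wsc: "ws ! j \<in> carrier_vec n" if "j < n" for j using ws that by (auto simp: subset_iff)
  have ip: "(\<Sum>i<n. cnj (ws ! k $ i) * ws ! j $ i) = ws ! j \<bullet>c ws ! k" if "j < n" "k < n" for j k
    using wsc[OF that(1)] wsc[OF that(2)]
    by (simp add: scalar_prod_def lessThan_atLeast0 mult.commute)
  have s_ip: "complex_of_real (s j) = ws ! j \<bullet>c ws ! j" if "j < n" for j
    unfolding ip[OF that that, symmetric] s_def
    by (simp add: complex_norm_square mult.commute del: of_real_power)
  have s_pos: "s j > 0" if "j < n" for j
  proof -
    have "s j \<noteq> 0" using s_ip[OF that] corthogonalD[OF ws(2), of j j] that ws(3) by auto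
    moreover have "s j \<ge> 0" unfolding s_def by (intro sum_nonneg) auto
    ultimately show ?thesis by simp
  qed
  have "mat_adjoint W * W = 1\<^sub>m n"
  proof (intro eq_matI)
    fix i j assume ij: "i < dim_row (1\<^sub>m n)" "j < dim_col (1\<^sub>m n)"
    have "(mat_adjoint W * W) $$ (i, j) = (\<Sum>k<n. complex_of_real (1 / sqrt (s i) * (1 / sqrt (s j))) *
        (cnj (ws ! i $ k) * ws ! j $ k))"
      using ij W by (subst index_mult_sum) (auto simp: W_def intro!: sum.cong)
    also have "\<dots> = complex_of_real (1 / sqrt (s i) * (1 / sqrt (s j))) * (ws ! j \<bullet>c ws ! i)"
      using ij ip by (simp only: sum_distrib_left[symmetric]) simp
    also have "\<dots> = (1\<^sub>m n :: complex mat) $$ (i, j)"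
    proof (cases "i = j")
      case True
      have "complex_of_real (1 / sqrt (s i) * (1 / sqrt (s i)) * s i) = 1"
        using s_pos[of i] ij by simp
      then show ?thesis using True ij s_ip[of i] by (metis index_one_mat(1,2) of_real_mult)
    next
      case False
      then show ?thesis using ij corthogonalD[OF ws(2), of j i] ws(3) by simp
    qed
    finally show "(mat_adjoint W * W) $$ (i, j) = (1\<^sub>m n) $$ (i, j)" .
  qed (use W in auto)
  then have "unitary_mat n W" using W by (rule unitary_matI[rotated])
  moreover have "W $$ (i, 0) = complex_of_real (1 / sqrt (s 0)) * v $ i" if "i < n" for i
    using that n ws0 by (simp add: W_def)
  ultimately show ?thesis using that by blast
qed

lemma mat_adjoint_four_block:
  fixes A B C D :: "complex mat"
  assumes "A \<in> carrier_mat n n" "B \<in> carrier_mat n m" "C \<in> carrier_mat m n" "D \<in> carrier_mat m m"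
  shows "mat_adjoint (four_block_mat A B C D)
    = four_block_mat (mat_adjoint A) (mat_adjoint C) (mat_adjoint B) (mat_adjoint D)"
  using assms by (intro eq_matI) auto

lemma mat_adjoint_one [simp]: "mat_adjoint (1\<^sub>m n) = (1\<^sub>m n :: complex mat)"
  by (intro eq_matI) auto

lemma mat_adjoint_zero [simp]: "mat_adjoint (0\<^sub>m n m) = (0\<^sub>m m n :: complex mat)"
  by (intro eq_matI) auto

text \<open>Deflation: a unitary whose first column is a multiple of an eigenvector clears the first
  column off the diagonal, Hermitian symmetry clears the first row, and the remaining block falls to
  the induction hypothesis.\<close>

lemma hermitian_diagonalisation:
  fixes A :: "complex mat"
  assumes "A \<in> carrier_mat n n" "mat_adjoint A = A"
  shows "\<exists>U d. unitary_mat n U \<and> A = U * real_diag n d * mat_adjoint U"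
  using assms
proof (induction n arbitrary: A)
  case 0
  then show ?case by (intro exI[of _ A]) (auto simp: unitary_mat_def intro!: eq_matI)
next
  case (Suc n)
  note A = Suc.prems(1) and herm = Suc.prems(2)
  let ?n = "Suc n"
  obtain e where "eigenvalue A e" using spectrum_non_empty[OF A] by (auto simp: spectrum_def)
  then obtain v where v: "v \<in> carrier_vec ?n" "v \<noteq> 0\<^sub>v ?n" "A *\<^sub>v v = e \<cdot>\<^sub>v v"
    using A by (auto simp: eigenvalue_def eigenvector_def)
  obtain W c where W: "unitary_mat ?n W" and Wv: "\<And>i. i < ?n \<Longrightarrow> W $$ (i, 0) = c * v $ i"
    using unitary_mat_first_column[OF v(1,2)] by blast
  have Wc: "W \<in> carrier_mat ?n ?n" and WW: "mat_adjoint W * W = 1\<^sub>m ?n" "W * mat_adjoint W = 1\<^sub>m ?n"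
    using W by (auto simp: unitary_mat_def)
  define A' where "A' = mat_adjoint W * (A * W)"
  have A': "A' \<in> carrier_mat ?n ?n" using A Wc by (simp add: A'_def)
  have hermA': "mat_adjoint A' = A'"
    using A Wc herm unfolding A'_def by (simp add: mat_adjoint_mult mult_mat_assoc)
  have AW: "(A * W) $$ (i, 0) = e * W $$ (i, 0)" if "i < ?n" for i
  proof -
    have "(A * W) $$ (i, 0) = (\<Sum>k<?n. A $$ (i, k) * W $$ (k, 0))"
      using that A Wc by (subst index_mult_sum) auto
    also have "\<dots> = c * (\<Sum>k<?n. A $$ (i, k) * v $ k)"
      unfolding sum_distrib_left by (intro sum.cong) (auto simp: Wv mult_ac)
    also have "(\<Sum>k<?n. A $$ (i, k) * v $ k) = (A *\<^sub>v v) $ i"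
      using that A v(1) by (auto simp: scalar_prod_def lessThan_atLeast0)
    also have "\<dots> = e * v $ i" using v that by simp
    finally show ?thesis using Wv[OF that] by simp
  qed
  have col0: "A' $$ (i, 0) = (if i = 0 then e else 0)" if "i < ?n" for i
  proof -
    have "A' $$ (i, 0) = (\<Sum>k<?n. mat_adjoint W $$ (i, k) * (A * W) $$ (k, 0))"
      unfolding A'_def using that A Wc by (subst index_mult_sum) auto
    also have "\<dots> = e * (\<Sum>k<?n. mat_adjoint W $$ (i, k) * W $$ (k, 0))"
      unfolding sum_distrib_left by (intro sum.cong) (auto simp: AW mult_ac)
    also have "(\<Sum>k<?n. mat_adjoint W $$ (i, k) * W $$ (k, 0)) = (mat_adjoint W * W) $$ (i, 0)"
      using that Wc by (subst index_mult_sum) auto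
    finally show ?thesis using that by (simp add: WW)
  qed
  have cnjA': "A' $$ (i, j) = cnj (A' $$ (j, i))" if "i < ?n" "j < ?n" for i j
    using hermA' that A' by (metis carrier_matD index_mat_adjoint)
  define r where "r = Re e"
  \<comment> \<open>The corner entry is its own conjugate, so the eigenvalue is real.\<close>
  have e: "e = complex_of_real r" using cnjA'[of 0 0] col0[of 0]
    by (simp add: r_def complex_eq_iff)
  define A3 where "A3 = mat n n (\<lambda>(i, j). A' $$ (Suc i, Suc j))"
  have "mat_adjoint A3 = A3"
  proof (intro eq_matI)
    fix i j assume "i < dim_row A3" "j < dim_col A3"
    then show "mat_adjoint A3 $$ (i, j) = A3 $$ (i, j)"
      using cnjA'[of "Suc i" "Suc j"] by (simp add: A3_def)
  qed (auto simp: A3_def)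
  moreover have A3: "A3 \<in> carrier_mat n n" by (simp add: A3_def)
  ultimately obtain U d where U: "unitary_mat n U" and A3d: "A3 = U * real_diag n d * mat_adjoint U"
    using Suc.IH[of A3] by blast
  have Uc: "U \<in> carrier_mat n n" and UU: "mat_adjoint U * U = 1\<^sub>m n"
    using U by (auto simp: unitary_mat_def)
  \<comment> \<open>\<open>V\<close> fixes the coordinate of the eigenvector and diagonalises the
    remaining block; \<open>d'\<close> puts the eigenvalue in front.\<close>
  define V where "V = four_block_mat (1\<^sub>m 1) (0\<^sub>m 1 n) (0\<^sub>m n 1) U"
  define d' where "d' i = (case i of 0 \<Rightarrow> r | Suc k \<Rightarrow> d k)" for i
  have Vc: "V \<in> carrier_mat ?n ?n" using Uc unfolding V_def by (intro carrier_matI) auto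
  have Va: "mat_adjoint V = four_block_mat (1\<^sub>m 1) (0\<^sub>m 1 n) (0\<^sub>m n 1) (mat_adjoint U)"
    unfolding V_def using Uc by (subst mat_adjoint_four_block[of _ 1 _ n]) auto
  have "mat_adjoint V * V = four_block_mat (1\<^sub>m 1) (0\<^sub>m 1 n) (0\<^sub>m n 1) (1\<^sub>m n)"
    unfolding Va unfolding V_def
    using Uc by (subst mult_four_block_mat[of _ 1 1 _ n _ n _ _ 1 _ n]) (auto simp: UU)
  also have "\<dots> = 1\<^sub>m ?n" by (intro eq_matI) auto
  finally have V: "unitary_mat ?n V" using Vc by (intro unitary_matI)
  have D': "real_diag ?n d' = four_block_mat (mat 1 1 (\<lambda>_. e)) (0\<^sub>m 1 n) (0\<^sub>m n 1) (real_diag n d)"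
    by (intro eq_matI) (auto simp: d'_def e split: nat.splits)
  have "V * real_diag ?n d' = four_block_mat (mat 1 1 (\<lambda>_. e)) (0\<^sub>m 1 n) (0\<^sub>m n 1) (U * real_diag n d)"
    unfolding D' unfolding V_def
    using Uc by (subst mult_four_block_mat[of _ 1 1 _ n _ n _ _ 1 _ n]) auto
  then have "V * real_diag ?n d' * mat_adjoint V =
      four_block_mat (mat 1 1 (\<lambda>_. e)) (0\<^sub>m 1 n) (0\<^sub>m n 1) A3"
    unfolding A3d Va
    using Uc by (simp, subst mult_four_block_mat[of _ 1 1 _ n _ n _ _ 1 _ n]) auto
  also have "\<dots> = A'"
  proof (intro eq_matI)
    fix i j assume "i < dim_row A'" "j < dim_col A'"
    then have ij: "i < ?n" "j < ?n" using A' by auto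
    have "A' $$ (0, j) = (if j = 0 then e else 0)"
      using cnjA'[of 0 j] col0[OF ij(2)] ij by (simp add: e)
    then show "four_block_mat (mat 1 1 (\<lambda>_. e)) (0\<^sub>m 1 n) (0\<^sub>m n 1) A3 $$ (i, j) = A' $$ (i, j)"
      using ij A3 col0[OF ij(1)] by (auto simp: A3_def)
  qed (use A' A3 in auto)
  finally have A'd: "A' = V * real_diag ?n d' * mat_adjoint V" by simp
  have "A = (W * mat_adjoint W) * A * (W * mat_adjoint W)" using A WW by simp
  also have "\<dots> = W * A' * mat_adjoint W" unfolding A'_def using A Wc by (simp add: mult_mat_assoc)
  also have "\<dots> = (W * V) * real_diag ?n d' * mat_adjoint (W * V)"
    unfolding A'd using Wc Vc by (simp add: mat_adjoint_mult mult_mat_assoc)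
  finally show ?case using unitary_mat_mult[OF W V] by blast
qed

section \<open>Local measurements\<close>

abbreviation gram :: "complex mat \<Rightarrow> complex mat" where
  "gram Y \<equiv> Y * mat_adjoint Y"

definition rowsq :: "complex mat \<Rightarrow> nat \<Rightarrow> real" where
  "rowsq Y k = (\<Sum>i<dim_col Y. (cmod (Y $$ (k, i)))\<^sup>2)"

definition colsq :: "complex mat \<Rightarrow> nat \<Rightarrow> real" where
  "colsq Y k = (\<Sum>i<dim_row Y. (cmod (Y $$ (i, k)))\<^sup>2)"

lemma rowsq_nonneg [simp]: "0 \<le> rowsq Y k"
  by (simp add: rowsq_def sum_nonneg)

lemma colsq_nonneg [simp]: "0 \<le> colsq Y k"
  by (simp add: colsq_def sum_nonneg)

lemma gram_diag: "k < dim_row Y \<Longrightarrow> gram Y $$ (k, k) = complex_of_real (rowsq Y k)"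
  by (subst index_mult_sum)
    (auto simp: rowsq_def complex_norm_square simp del: of_real_power intro!: sum.cong)

lemma adjoint_gram_diag: "k < dim_col Y \<Longrightarrow> (mat_adjoint Y * Y) $$ (k, k) = complex_of_real (colsq Y k)"
  by (subst index_mult_sum)
    (auto simp: colsq_def complex_norm_square mult.commute simp del: of_real_power intro!: sum.cong)

lemma colsq_transpose: "k < dim_row Y \<Longrightarrow> colsq (transpose_mat Y) k = rowsq Y k"
  by (simp add: colsq_def rowsq_def)

lemma kraus_family_carrier:
  assumes "kraus_family n Ks" "K \<in> set Ks"
  obtains r where "K \<in> carrier_mat r n"
  using assms that[of "dim_row K"] by (auto simp: kraus_family_def)

text \<open>The completeness relation placed between \<open>mat_adjoint Y\<close> and
  \<open>Y\<close> and read off on the diagonal.\<close>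

lemma kraus_family_colsq:
  assumes K: "kraus_family n Ks" and Y: "Y \<in> carrier_mat n m" and k: "k < m"
  shows "(\<Sum>K\<leftarrow>Ks. colsq (K * Y) k) = colsq Y k"
proof -
  let ?S = "\<lambda>Ks. foldr (\<lambda>K S. mat_adjoint K * K + S) Ks (0\<^sub>m n n)"
  \<comment> \<open>The induction is about arbitrary partial sums, since the tail of a complete
    family need not be complete.\<close>
  have "?S Ks \<in> carrier_mat n n \<and>
      complex_of_real (\<Sum>K\<leftarrow>Ks. colsq (K * Y) k) = (mat_adjoint Y * (?S Ks * Y)) $$ (k, k)"
    if "\<forall>K\<in>set Ks. dim_col K = n" for Ks :: "complex mat list"
    using that
  proof (induction Ks)
    case Nil
    then show ?case using Y k by simp
  next
    case (Cons K Ks)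
    define T where "T = ?S Ks"
    have T: "T \<in> carrier_mat n n"
      and IH: "complex_of_real (\<Sum>K\<leftarrow>Ks. colsq (K * Y) k) = (mat_adjoint Y * (T * Y)) $$ (k, k)"
      using Cons by (auto simp: T_def)
    define r where "r = dim_row K"
    have Kc: "K \<in> carrier_mat r n" using Cons.prems by (auto simp: r_def)
    have KK: "mat_adjoint K * K \<in> carrier_mat n n" using Kc by simp
    have "mat_adjoint (K * Y) * (K * Y) = mat_adjoint Y * ((mat_adjoint K * K) * Y)"
      using Kc Y by (simp add: mat_adjoint_mult mult_mat_assoc
        mult_mat_assoc)
    moreover have "(mat_adjoint (K * Y) * (K * Y)) $$ (k, k) = complex_of_real (colsq (K * Y) k)"
      using k Y by (intro adjoint_gram_diag) auto
    ultimately have e: "complex_of_real (colsq (K * Y) k) = (mat_adjoint Y * ((mat_adjoint K * K) * Y)) $$ (k, k)"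
      by simp
    have "mat_adjoint Y * ((mat_adjoint K * K + T) * Y)
        = mat_adjoint Y * ((mat_adjoint K * K) * Y) + mat_adjoint Y * (T * Y)"
      using KK T Y
      by (simp add: add_mult_distrib_mat[of _ n n] mult_add_distrib_mat[of _ m n _ m])
    then show ?case using e IH KK T Y k by (simp add: T_def[symmetric] del: index_mult_mat(1))
  qed
  then have "complex_of_real (\<Sum>K\<leftarrow>Ks. colsq (K * Y) k) = (mat_adjoint Y * (?S Ks * Y)) $$ (k, k)"
    using K by (auto simp: kraus_family_def)
  also have "\<dots> = (mat_adjoint Y * Y) $$ (k, k)" using K Y by (simp add: kraus_family_def)
  also have "\<dots> = complex_of_real (colsq Y k)" using k Y by (intro adjoint_gram_diag) auto
  finally show ?thesis by (simp only: of_real_eq_iff)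
qed

lemma unitary_colsq:
  assumes U: "unitary_mat n U" and Y: "Y \<in> carrier_mat n m" and k: "k < m"
  shows "colsq (mat_adjoint U * Y) k = colsq Y k"
proof -
  \<comment> \<open>The adjoint unitary is a measurement with a single outcome.\<close>
  have "kraus_family n [mat_adjoint U]"
    using U by (auto simp: kraus_family_def unitary_mat_def)
  from kraus_family_colsq[OF this Y k] show ?thesis by simp
qed

section \<open>Trace functionals, spectra and majorisation\<close>

definition trace_fun :: "(real \<Rightarrow> real) \<Rightarrow> complex mat \<Rightarrow> real" where
  "trace_fun f \<rho> = Re (mat_trace (herm_fun f \<rho>))"

text \<open>The diagonals of the two unitarity relations; together they make the squared moduli a
  doubly stochastic matrix.\<close>

lemma unitary_rows:
  assumes U: "unitary_mat n U"
  shows "k < n \<Longrightarrow> (\<Sum>l<n. (cmod (U $$ (k, l)))\<^sup>2) = 1"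
    and "l < n \<Longrightarrow> (\<Sum>k<n. (cmod (U $$ (k, l)))\<^sup>2) = 1"
proof -
  have Uc: "U \<in> carrier_mat n n" using U by (simp add: unitary_mat_def)
  show "(\<Sum>l<n. (cmod (U $$ (k, l)))\<^sup>2) = 1" if "k < n"
  proof -
    have g: "gram U = 1\<^sub>m n" using U by (simp add: unitary_mat_def)
    have "complex_of_real (rowsq U k) = gram U $$ (k, k)" using gram_diag[of k U] that Uc by simp
    also have "\<dots> = 1" unfolding g using that by simp
    finally show ?thesis using Uc by (simp only: of_real_eq_1_iff) (simp add: rowsq_def)
  qed
  show "(\<Sum>k<n. (cmod (U $$ (k, l)))\<^sup>2) = 1" if "l < n"
  proof -
    have g: "mat_adjoint U * U = 1\<^sub>m n" using U by (simp add: unitary_mat_def)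
    have "complex_of_real (colsq U l) = (mat_adjoint U * U) $$ (l, l)"
      using adjoint_gram_diag[of l U] that Uc by simp
    also have "\<dots> = 1" unfolding g using that by simp
    finally show ?thesis using Uc by (simp only: of_real_eq_1_iff) (simp add: colsq_def)
  qed
qed

lemma conj_diag_entry:
  assumes U: "U \<in> carrier_mat n n" and k: "k < n"
  shows "(U * real_diag n d * mat_adjoint U) $$ (k, k)
    = complex_of_real (\<Sum>l<n. (cmod (U $$ (k, l)))\<^sup>2 * d l)"
proof -
  have UD: "U * real_diag n d = mat n n (\<lambda>(i, j). U $$ (i, j) * complex_of_real (d j))"
    unfolding real_diag_def by (rule mat_diag_mult_right[OF U])
  show ?thesis unfolding UD using U k
    by (subst index_mult_sum)
      (auto simp: complex_norm_square algebra_simps simp del: of_real_power intro!: sum.cong)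
qed

text \<open>Uniqueness pins down the choice made in \<open>herm_fun\<close>, so any convenient
  diagonalisation computes it.\<close>

lemma herm_fun_eq:
  assumes "unitary_mat n U" "\<rho> = U * real_diag n d * mat_adjoint U"
  shows "herm_fun f \<rho> = U * real_diag n (\<lambda>i. f (d i)) * mat_adjoint U"
proof -
  have "dim_row \<rho> = n" using assms by (auto simp: unitary_mat_def)
  then have r: "herm_fun_rel f \<rho> (U * real_diag n (\<lambda>i. f (d i)) * mat_adjoint U)"
    using assms unfolding herm_fun_rel_def by blast
  show ?thesis unfolding herm_fun_def
    using r by (intro some_equality) (auto intro: herm_fun_unique)
qed

lemma trace_conj_diag:
  assumes "unitary_mat n U"
  shows "mat_trace (U * real_diag n d * mat_adjoint U) = complex_of_real (\<Sum>i<n. d i)"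
proof -
  have U: "U \<in> carrier_mat n n" using assms by (simp add: unitary_mat_def)
  have "mat_trace (U * real_diag n d * mat_adjoint U) = (\<Sum>k<n. complex_of_real (\<Sum>l<n. (cmod (U $$ (k, l)))\<^sup>2 * d l))"
    unfolding mat_trace_def using U by (intro sum.cong) (auto simp: conj_diag_entry simp del: index_mult_mat(1))
  also have "\<dots> = complex_of_real (\<Sum>l<n. (\<Sum>k<n. (cmod (U $$ (k, l)))\<^sup>2) * d l)"
    unfolding of_real_sum[symmetric] by (subst sum.swap) (simp add: sum_distrib_right)
  also have "\<dots> = complex_of_real (\<Sum>l<n. d l)"
    using unitary_rows(2)[OF assms] by simp
  finally show ?thesis .
qed

lemma trace_fun_eq:
  assumes "unitary_mat n U" "\<rho> = U * real_diag n d * mat_adjoint U"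
  shows "trace_fun f \<rho> = (\<Sum>i<n. f (d i))"
  by (simp add: trace_fun_def herm_fun_eq[OF assms] trace_conj_diag[OF assms(1)] del: of_real_sum)

text \<open>Phrased through traces so that it depends on the matrix alone; the next lemma then
  accepts whichever diagonalisation is at hand.\<close>

definition mat_scaled_entropy :: "real \<Rightarrow> complex mat \<Rightarrow> real" where
  "mat_scaled_entropy \<alpha> \<rho> = (if \<alpha> = 1
     then trace_fun (\<lambda>x. - x * ln x) \<rho> + trace_fun (\<lambda>x. x) \<rho> * ln (trace_fun (\<lambda>x. x) \<rho>)
     else sgn (1 - \<alpha>) * trace_fun (\<lambda>x. x powr \<alpha>) \<rho> powr (1 / \<alpha>))"

lemma mat_scaled_entropy_eq:
  assumes "unitary_mat n U" "\<rho> = U * real_diag n d * mat_adjoint U"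
  shows "mat_scaled_entropy \<alpha> \<rho> = scaled_entropy \<alpha> n d"
  by (simp add: mat_scaled_entropy_def scaled_entropy_def trace_fun_eq[OF assms])

text \<open>Written as squared row norms, the eigenvalues are visibly nonnegative. The diagonal Gram
  matrix says that the rows of \<open>mat_adjoint U * Y\<close> are orthogonal.\<close>

lemma gram_diagonalisation:
  assumes Y: "Y \<in> carrier_mat n m"
  obtains U d where "unitary_mat n U" "gram Y = U * real_diag n d * mat_adjoint U"
    "gram (mat_adjoint U * Y) = real_diag n d" "\<And>k. k < n \<Longrightarrow> d k = rowsq (mat_adjoint U * Y) k"
proof -
  have G: "gram Y \<in> carrier_mat n n" using Y by simp
  have "mat_adjoint (gram Y) = gram Y" using Y by (simp add: mat_adjoint_mult)
  then obtain U d where U: "unitary_mat n U" and d: "gram Y = U * real_diag n d * mat_adjoint U"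
    using hermitian_diagonalisation[OF G] by blast
  have Uc: "U \<in> carrier_mat n n" and UU: "mat_adjoint U * U = 1\<^sub>m n" using U by (auto simp: unitary_mat_def)
  have "gram (mat_adjoint U * Y) = mat_adjoint U * gram Y * U"
    using Uc Y by (simp add: mat_adjoint_mult mult_mat_assoc
        mult_mat_assoc)
  also have "\<dots> = (mat_adjoint U * U) * real_diag n d * (mat_adjoint U * U)"
    unfolding d using Uc by (simp add: mult_mat_assoc)
  finally have g: "gram (mat_adjoint U * Y) = real_diag n d" by (simp add: UU)
  have "d k = rowsq (mat_adjoint U * Y) k" if "k < n" for k
  proof -
    have "complex_of_real (rowsq (mat_adjoint U * Y) k) = gram (mat_adjoint U * Y) $$ (k, k)"
      using gram_diag[of k "mat_adjoint U * Y"] Uc that by simp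
    also have "\<dots> = complex_of_real (d k)" unfolding g using that by simp
    finally show ?thesis by (simp only: of_real_eq_iff)
  qed
  with U d g show ?thesis using that by blast
qed

lemma mat_scaled_entropy_unitary:
  assumes U: "unitary_mat n U" and Y: "Y \<in> carrier_mat n m"
  shows "mat_scaled_entropy \<alpha> (gram (mat_adjoint U * Y)) = mat_scaled_entropy \<alpha> (gram Y)"
proof -
  obtain W d where W: "unitary_mat n W" and d: "gram Y = W * real_diag n d * mat_adjoint W"
    using gram_diagonalisation[OF Y] by blast
  have c: "U \<in> carrier_mat n n" "W \<in> carrier_mat n n" using U W by (auto simp: unitary_mat_def)
  have U': "unitary_mat n (mat_adjoint U)" using U by (auto simp: unitary_mat_def)
  have "gram (mat_adjoint U * Y) = mat_adjoint U * gram Y * U"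
    using c Y by (simp add: mat_adjoint_mult mult_mat_assoc
        mult_mat_assoc)
  also have "\<dots> = (mat_adjoint U * W) * real_diag n d * mat_adjoint (mat_adjoint U * W)"
    unfolding d using c by (simp add: mat_adjoint_mult mult_mat_assoc)
  finally show ?thesis
    using mat_scaled_entropy_eq[OF unitary_mat_mult[OF U' W]] mat_scaled_entropy_eq[OF W d] by simp
qed

text \<open>Schur's majorisation: the squared row norms are the diagonal of \<open>gram Y\<close>,
  hence a doubly stochastic image of its eigenvalues.\<close>

lemma mat_scaled_entropy_le_rowsq:
  assumes \<alpha>: "0 < \<alpha>" and Y: "Y \<in> carrier_mat n m"
  shows "mat_scaled_entropy \<alpha> (gram Y) \<le> scaled_entropy \<alpha> n (rowsq Y)"
proof -
  obtain W \<mu> where W: "unitary_mat n W" and d: "gram Y = W * real_diag n \<mu> * mat_adjoint W"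
    and \<mu>: "\<And>k. k < n \<Longrightarrow> \<mu> k = rowsq (mat_adjoint W * Y) k"
    using gram_diagonalisation[OF Y] by blast
  have Wc: "W \<in> carrier_mat n n" using W by (simp add: unitary_mat_def)
  have "rowsq Y k = (\<Sum>l<n. (cmod (W $$ (k, l)))\<^sup>2 * \<mu> l)" if "k < n" for k
  proof -
    have "complex_of_real (rowsq Y k) = gram Y $$ (k, k)"
      using gram_diag[of k Y] Y that by simp
    also have "\<dots> = complex_of_real (\<Sum>l<n. (cmod (W $$ (k, l)))\<^sup>2 * \<mu> l)"
      unfolding d using conj_diag_entry[OF Wc that] .
    finally show ?thesis by (simp only: of_real_eq_iff)
  qed
  then have "scaled_entropy \<alpha> n \<mu> \<le> scaled_entropy \<alpha> n (rowsq Y)"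
    using unitary_rows[OF W] \<mu>
    by (intro scaled_entropy_substochastic[OF \<alpha>, where S = "\<lambda>k l. (cmod (W $$ (k, l)))\<^sup>2"]) auto
  then show ?thesis using mat_scaled_entropy_eq[OF W d] by simp
qed

text \<open>Bessel's inequality for the k-th unit vector against an orthogonal family with squared
  norms \<open>\<mu> l\<close>. Division by 0 gives 0, so null vectors of the family drop
  out.\<close>

lemma bessel_weights:
  fixes c :: "nat \<Rightarrow> nat \<Rightarrow> complex" and \<mu> :: "nat \<Rightarrow> real"
  assumes orth: "\<And>l l'. l < n \<Longrightarrow> l' < n \<Longrightarrow>
      (\<Sum>k<m. c l k * cnj (c l' k)) = (if l = l' then complex_of_real (\<mu> l) else 0)"
    and \<mu>: "\<And>l. l < n \<Longrightarrow> 0 \<le> \<mu> l" and k: "k < m"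
  shows "(\<Sum>l<n. (cmod (c l k))\<^sup>2 / \<mu> l) \<le> 1"
proof -
  \<comment> \<open>\<open>y\<close> is the orthogonal projection of the k-th unit vector onto the
    span of the family. Its k-th coordinate and its squared norm are both \<open>q\<close>, whence
    \<open>q\<^sup>2 \<le> q\<close>.\<close>
  define y where "y j = (\<Sum>l<n. cnj (c l k) * c l j / complex_of_real (\<mu> l))" for j
  define q where "q = (\<Sum>l<n. (cmod (c l k))\<^sup>2 / \<mu> l)"
  have q0: "q \<ge> 0" unfolding q_def using \<mu> by (intro sum_nonneg) auto
  have yk: "y k = complex_of_real q"
    unfolding y_def q_def by (simp add: complex_norm_square mult.commute del: of_real_power)
  have "complex_of_real (\<Sum>j<m. (cmod (y j))\<^sup>2) = (\<Sum>j<m. \<Sum>l<n. \<Sum>l'<n.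
      cnj (c l k) * c l' k / complex_of_real (\<mu> l * \<mu> l') * (c l j * cnj (c l' j)))"
    unfolding of_real_sum complex_norm_square y_def cnj_sum sum_product
    by (intro sum.cong refl) (simp add: field_simps)
  also have "\<dots> = (\<Sum>l<n. \<Sum>j<m. \<Sum>l'<n.
      cnj (c l k) * c l' k / complex_of_real (\<mu> l * \<mu> l') * (c l j * cnj (c l' j)))"
    by (rule sum.swap)
  also have "\<dots> = (\<Sum>l<n. \<Sum>l'<n. cnj (c l k) * c l' k / complex_of_real (\<mu> l * \<mu> l') *
      (\<Sum>j<m. c l j * cnj (c l' j)))"
    unfolding sum_distrib_left
    by (rule sum.cong[OF refl], rule sum.swap)
  also have "\<dots> = (\<Sum>l<n. \<Sum>l'<n. if l = l' then
      complex_of_real ((cmod (c l k))\<^sup>2 / (\<mu> l * \<mu> l) * \<mu> l) else 0)"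
    by (intro sum.cong refl) (auto simp: orth complex_norm_square mult.commute simp del: of_real_power)
  also have "\<dots> = complex_of_real q"
    unfolding q_def of_real_sum by (intro sum.cong refl) (auto simp: sum.delta)
  finally have "(\<Sum>j<m. (cmod (y j))\<^sup>2) = q" by (simp only: of_real_eq_iff)
  moreover have "(cmod (y k))\<^sup>2 \<le> (\<Sum>j<m. (cmod (y j))\<^sup>2)"
    using k by (intro member_le_sum) auto
  ultimately have "q\<^sup>2 \<le> q" using q0 by (simp add: yk)
  then show ?thesis
    unfolding q_def[symmetric] using q0
    by (cases "q = 0") (auto simp: power2_eq_square)
qed

text \<open>The squared column norms are the diagonal of \<open>mat_adjoint Y * Y\<close>, which has
  the nonzero spectrum of \<open>gram Y\<close> but possibly another size; the weights linking the
  two are therefore only substochastic.\<close>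

lemma mat_scaled_entropy_le_colsq:
  assumes \<alpha>: "0 < \<alpha>" and Y: "Y \<in> carrier_mat n m"
  shows "mat_scaled_entropy \<alpha> (gram Y) \<le> scaled_entropy \<alpha> m (colsq Y)"
proof -
  obtain W \<mu> where W: "unitary_mat n W" and d: "gram Y = W * real_diag n \<mu> * mat_adjoint W"
    and D: "gram (mat_adjoint W * Y) = real_diag n \<mu>"
    and \<mu>: "\<And>k. k < n \<Longrightarrow> \<mu> k = rowsq (mat_adjoint W * Y) k"
    using gram_diagonalisation[OF Y] by blast
  define C where "C = mat_adjoint W * Y"
  have C: "C \<in> carrier_mat n m" using W Y by (auto simp: C_def unitary_mat_def)
  have \<mu>0: "0 \<le> \<mu> l" if "l < n" for l using \<mu>[OF that] by simp
  have \<mu>C: "\<mu> l = (\<Sum>k<m. (cmod (C $$ (l, k)))\<^sup>2)" if "l < n" for l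
    using \<mu>[OF that] C by (simp add: C_def[symmetric] rowsq_def)
  have orth: "(\<Sum>k<m. C $$ (l, k) * cnj (C $$ (l', k))) = (if l = l' then complex_of_real (\<mu> l) else 0)"
    if "l < n" "l' < n" for l l'
  proof -
    have "(\<Sum>k<m. C $$ (l, k) * cnj (C $$ (l', k))) = gram C $$ (l, l')"
      using that C by (subst index_mult_sum) auto
    then show ?thesis using that D by (simp add: C_def[symmetric])
  qed
  \<comment> \<open>A null eigenvalue forces its whole row of \<open>C\<close> to vanish, so
    dividing by 0 loses nothing.\<close>
  have z: "(cmod (C $$ (l, k)))\<^sup>2 = (cmod (C $$ (l, k)))\<^sup>2 / \<mu> l * \<mu> l" if "l < n" "k < m" for l k
  proof (cases "\<mu> l = 0")
    case True
    then have "\<forall>k\<in>{..<m}. (cmod (C $$ (l, k)))\<^sup>2 = 0"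
      using \<mu>C[OF that(1)] sum_nonneg_eq_0_iff[of "{..<m}" "\<lambda>k. (cmod (C $$ (l, k)))\<^sup>2"] by simp
    then show ?thesis using that by simp
  qed simp
  have "scaled_entropy \<alpha> n \<mu> \<le> scaled_entropy \<alpha> m (colsq Y)"
  \<comment> \<open>The rows of C are orthogonal with squared norms \<open>\<mu> l\<close>, so Bessel's inequality for the k-th
    unit vector bounds the sum over l.\<close>
  proof (rule scaled_entropy_substochastic[OF \<alpha>, where S = "\<lambda>k l. (cmod (C $$ (l, k)))\<^sup>2 / \<mu> l"])
    fix k l assume "k < m" "l < n"
    then show "0 \<le> (cmod (C $$ (l, k)))\<^sup>2 / \<mu> l" using \<mu>0 by simp
  next
    fix k assume "k < m"
    then show "(\<Sum>l<n. (cmod (C $$ (l, k)))\<^sup>2 / \<mu> l) \<le> 1"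
      using bessel_weights[where c = "\<lambda>l k. C $$ (l, k)" and n = n and m = m and \<mu> = \<mu>] orth \<mu>0 by simp
  next
    fix l assume "l < n" "\<mu> l \<noteq> 0"
    then show "(\<Sum>k<m. (cmod (C $$ (l, k)))\<^sup>2 / \<mu> l) = 1"
      using \<mu>C[of l] by (simp add: sum_divide_distrib[symmetric])
  next
    fix k assume k: "k < m"
    have "colsq Y k = colsq C k" unfolding C_def using unitary_colsq[OF W Y k] by simp
    then show "colsq Y k = (\<Sum>l<n. (cmod (C $$ (l, k)))\<^sup>2 / \<mu> l * \<mu> l)"
      using z k C by (simp add: colsq_def)
  qed (use \<mu>0 in auto)
  then show ?thesis using mat_scaled_entropy_eq[OF W d] by simp
qed

text \<open>In an eigenbasis of \<open>gram N\<close> the squared row norms are the eigenvalues. A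
  acts on the column index, so transposing \<open>G\<close> turns these rows into columns on which
  \<open>K\<close> acts from the left, and \<open>kraus_family_colsq\<close> applies.\<close>

lemma measure_A_step:
  assumes \<alpha>: "0 < \<alpha>" and K: "kraus_family a Ks" and N: "N \<in> carrier_mat b a"
  shows "(\<Sum>K\<leftarrow>Ks. mat_scaled_entropy \<alpha> (gram (N * transpose_mat K))) \<le> mat_scaled_entropy \<alpha> (gram N)"
proof -
  obtain U d where U: "unitary_mat b U" and d: "gram N = U * real_diag b d * mat_adjoint U"
    and d': "\<And>k. k < b \<Longrightarrow> d k = rowsq (mat_adjoint U * N) k"
    using gram_diagonalisation[OF N] by blast
  define G where "G = mat_adjoint U * N"
  have Uc: "U \<in> carrier_mat b b" using U by (simp add: unitary_mat_def)
  then have G: "G \<in> carrier_mat b a" using N by (simp add: G_def)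
  have "(\<Sum>K\<leftarrow>Ks. mat_scaled_entropy \<alpha> (gram (N * transpose_mat K))) \<le> (\<Sum>K\<leftarrow>Ks. scaled_entropy \<alpha> b (colsq (K * transpose_mat G)))"
  proof (intro sum_list_mono)
    fix K assume "K \<in> set Ks"
    then obtain r where Kc: "K \<in> carrier_mat r a" by (rule kraus_family_carrier[OF K])
    then have NK: "N * transpose_mat K \<in> carrier_mat b r" using N by simp
    have GK: "mat_adjoint U * (N * transpose_mat K) = G * transpose_mat K"
      unfolding G_def using Uc N Kc by (simp add: mult_mat_assoc)
    have "mat_scaled_entropy \<alpha> (gram (N * transpose_mat K)) = mat_scaled_entropy \<alpha> (gram (G * transpose_mat K))"
      using mat_scaled_entropy_unitary[OF U NK] by (simp add: GK)
    also have "\<dots> \<le> scaled_entropy \<alpha> b (rowsq (G * transpose_mat K))"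
      using G Kc by (intro mat_scaled_entropy_le_rowsq[OF \<alpha>, of _ _ r]) simp
    also have "\<dots> = scaled_entropy \<alpha> b (colsq (K * transpose_mat G))"
    proof (intro scaled_entropy_cong)
      fix k assume "k < b"
      then have "colsq (transpose_mat (G * transpose_mat K)) k = rowsq (G * transpose_mat K) k"
        using G by (intro colsq_transpose) simp
      moreover have "transpose_mat (G * transpose_mat K) = K * transpose_mat G"
        using G Kc by (simp add: transpose_mult[of _ b a _ r])
      ultimately show "rowsq (G * transpose_mat K) k = colsq (K * transpose_mat G) k" by simp
    qed
    finally show "mat_scaled_entropy \<alpha> (gram (N * transpose_mat K)) \<le> scaled_entropy \<alpha> b (colsq (K * transpose_mat G))" .
  qed
  also have "\<dots> \<le> scaled_entropy \<alpha> b (\<lambda>k. \<Sum>K\<leftarrow>Ks. colsq (K * transpose_mat G) k)"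
    by (intro scaled_entropy_superadd_list[OF \<alpha>]) simp
  also have "\<dots> = scaled_entropy \<alpha> b d"
  proof (intro scaled_entropy_cong)
    fix k assume k: "k < b"
    have "(\<Sum>K\<leftarrow>Ks. colsq (K * transpose_mat G) k) = colsq (transpose_mat G) k"
      using G k by (intro kraus_family_colsq[OF K, of _ b]) auto
    then show "(\<Sum>K\<leftarrow>Ks. colsq (K * transpose_mat G) k) = d k"
      using G k d'[OF k] by (simp add: colsq_transpose G_def[symmetric])
  qed
  finally show ?thesis using mat_scaled_entropy_eq[OF U d] by simp
qed

text \<open>The column norms of \<open>N\<close> need not give the spectrum, so \<open>N\<close> is
  replaced by a square matrix \<open>Z\<close> with the same Gram matrix whose squared column norms
  are the eigenvalues.\<close>

lemma measure_B_step:
  assumes \<alpha>: "0 < \<alpha>" and K: "kraus_family b Ks" and N: "N \<in> carrier_mat b a"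
  shows "(\<Sum>K\<leftarrow>Ks. mat_scaled_entropy \<alpha> (gram (K * N))) \<le> mat_scaled_entropy \<alpha> (gram N)"
proof -
  obtain U d where U: "unitary_mat b U" and d: "gram N = U * real_diag b d * mat_adjoint U"
    and d': "\<And>k. k < b \<Longrightarrow> d k = rowsq (mat_adjoint U * N) k"
    using gram_diagonalisation[OF N] by blast
  define Q where "Q = real_diag b (\<lambda>k. sqrt (d k))"
  define Z where "Z = U * Q"
  have Uc: "U \<in> carrier_mat b b" using U by (simp add: unitary_mat_def)
  have Q: "Q \<in> carrier_mat b b" by (simp add: Q_def)
  have Z: "Z \<in> carrier_mat b b" using Uc Q by (simp add: Z_def)
  have Qa: "mat_adjoint Q = Q" by (intro eq_matI) (auto simp: Q_def)
  \<comment> \<open>Nonnegativity of the eigenvalues enters here, through \<open>d'\<close>: the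
    square roots have to square back.\<close>
  have QQ: "Q * Q = real_diag b d"
    unfolding Q_def real_diag_def mat_diag_diag
    using d' by (intro eq_matI) (auto simp: mat_diag_def of_real_mult[symmetric] simp del: of_real_mult)
  have ZZ: "gram Z = gram N"
    unfolding d Z_def QQ[symmetric] using Uc Q
    by (simp add: mat_adjoint_mult Qa mult_mat_assoc)
  have ZZ': "mat_adjoint Z * Z = real_diag b d"
  proof -
    have "mat_adjoint Z * Z = Q * ((mat_adjoint U * U) * Q)"
      unfolding Z_def using Uc Q
      by (simp add: mat_adjoint_mult Qa mult_mat_assoc)
    then show ?thesis using U Q QQ by (simp add: unitary_mat_def)
  qed
  have colZ: "colsq Z k = d k" if "k < b" for k
    using adjoint_gram_diag[of k Z] that Z unfolding ZZ' by simp
  have "(\<Sum>K\<leftarrow>Ks. mat_scaled_entropy \<alpha> (gram (K * N))) \<le> (\<Sum>K\<leftarrow>Ks. scaled_entropy \<alpha> b (colsq (K * Z)))"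
  proof (intro sum_list_mono)
    fix K assume "K \<in> set Ks"
    then obtain r where Kc: "K \<in> carrier_mat r b" by (rule kraus_family_carrier[OF K])
    have g: "gram (K * X) = K * gram X * mat_adjoint K" if X: "X \<in> carrier_mat b c" for X c
    proof -
      have "gram (K * X) = K * X * (mat_adjoint X * mat_adjoint K)"
        using X Kc by (simp add: mat_adjoint_mult)
      also have "\<dots> = K * (X * (mat_adjoint X * mat_adjoint K))"
        using X Kc by (simp add: mult_mat_assoc)
      also have "X * (mat_adjoint X * mat_adjoint K) = gram X * mat_adjoint K"
        using X Kc by (simp add: mult_mat_assoc)
      also have "K * (gram X * mat_adjoint K) = K * gram X * mat_adjoint K"
        using X Kc by (simp add: mult_mat_assoc)
      finally show ?thesis .
    qed
    \<comment> \<open>The Gram matrix of an outcome depends on \<open>N\<close> only through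
      \<open>gram N\<close>, which permits the exchange.\<close>
    have "gram (K * N) = gram (K * Z)" using g[OF N] g[OF Z] ZZ by simp
    then show "mat_scaled_entropy \<alpha> (gram (K * N)) \<le> scaled_entropy \<alpha> b (colsq (K * Z))"
      using mat_scaled_entropy_le_colsq[OF \<alpha>, of "K * Z" r b] Kc Z by simp
  qed
  also have "\<dots> \<le> scaled_entropy \<alpha> b (\<lambda>k. \<Sum>K\<leftarrow>Ks. colsq (K * Z) k)"
    by (intro scaled_entropy_superadd_list[OF \<alpha>]) simp
  also have "\<dots> = scaled_entropy \<alpha> b d"
    using kraus_family_colsq[OF K Z] colZ by (intro scaled_entropy_cong) simp
  finally show ?thesis using mat_scaled_entropy_eq[OF U d] by simp
qed

section \<open>Induction over the protocol tree\<close>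

lemma branches_dim_col:
  "slocc_protocol a b P \<Longrightarrow> (A, B) \<in> set (branches a b P) \<Longrightarrow> dim_col A = a \<and> dim_col B = b"
proof (induction arbitrary: A B rule: slocc_protocol.induct)
  case (Measure_A a Ks b)
  then obtain K P A' where KP: "(K, P) \<in> set Ks" and A': "(A', B) \<in> set (branches (dim_row K) b P)"
    and A: "A = A' * K" by auto
  have "K \<in> set (map fst Ks)" using KP by force
  then obtain r where "K \<in> carrier_mat r a" by (rule kraus_family_carrier[OF Measure_A(1)])
  then show ?case using Measure_A(3)[OF KP A'] A by simp
next
  case (Measure_B b Ks a)
  then obtain K P B' where KP: "(K, P) \<in> set Ks" and B': "(A, B') \<in> set (branches a (dim_row K) P)"
    and B: "B = B' * K" by auto
  have "K \<in> set (map fst Ks)" using KP by force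
  then obtain r where "K \<in> carrier_mat r b" by (rule kraus_family_carrier[OF Measure_B(1)])
  then show ?case using Measure_B(3)[OF KP B'] B by simp
qed simp

lemma sum_list_concat_map:
  "sum_list (map f (concat (map g xs))) = (\<Sum>x\<leftarrow>xs. sum_list (map f (g x)))"
  by (induction xs) auto

text \<open>The induction runs over unnormalised coefficient matrices: after an outcome
  \<open>K\<close> the remaining protocol starts from \<open>N * transpose_mat K\<close> or
  \<open>K * N\<close>, to which the hypothesis applies, and the step lemma bounds the sum over
  \<open>K\<close>.\<close>

lemma mat_scaled_entropy_branches:
  assumes \<alpha>: "0 < \<alpha>" and "slocc_protocol a b P" and "N \<in> carrier_mat b a"
  shows "(\<Sum>(A, B)\<leftarrow>branches a b P. mat_scaled_entropy \<alpha> (gram (B * N * transpose_mat A))) \<le> mat_scaled_entropy \<alpha> (gram N)"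
  using assms(2,3)
proof (induction arbitrary: N rule: slocc_protocol.induct)
  case (Stop a b)
  then show ?case by simp
next
  case (Measure_A a Ks b)
  have "(\<Sum>(A, B)\<leftarrow>branches a b (Measure_A Ks). mat_scaled_entropy \<alpha> (gram (B * N * transpose_mat A)))
      = (\<Sum>(K, P)\<leftarrow>Ks. \<Sum>(A, B)\<leftarrow>branches (dim_row K) b P. mat_scaled_entropy \<alpha> (gram (B * N * transpose_mat (A * K))))"
    by (simp add: sum_list_concat_map case_prod_unfold comp_def)
  also have "\<dots> \<le> (\<Sum>(K, P)\<leftarrow>Ks. mat_scaled_entropy \<alpha> (gram (N * transpose_mat K)))"
  proof (intro sum_list_mono, clarify)
    fix K P assume KP: "(K, P) \<in> set Ks"
    then have "K \<in> set (map fst Ks)" by force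
    then obtain r where Kc: "K \<in> carrier_mat r a" by (rule kraus_family_carrier[OF Measure_A(1)])
    have NK: "N * transpose_mat K \<in> carrier_mat b (dim_row K)" using Kc Measure_A.prems by simp
    have "(\<Sum>(A, B)\<leftarrow>branches (dim_row K) b P. mat_scaled_entropy \<alpha> (gram (B * N * transpose_mat (A * K))))
        = (\<Sum>(A, B)\<leftarrow>branches (dim_row K) b P. mat_scaled_entropy \<alpha> (gram (B * (N * transpose_mat K) * transpose_mat A)))"
    proof (intro arg_cong[of _ _ sum_list] map_cong refl, clarify)
      fix A B assume "(A, B) \<in> set (branches (dim_row K) b P)"
      then have "dim_col A = dim_row K" "dim_col B = b"
        using branches_dim_col[OF Measure_A(2)[OF KP]] by auto
      have "B * N * transpose_mat (A * K) = B * N * (transpose_mat K * transpose_mat A)"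
        using \<open>dim_col A = dim_row K\<close> Kc
        by (subst transpose_mult[of A "dim_row A" r K a]) auto
      also have "\<dots> = B * N * transpose_mat K * transpose_mat A"
        using \<open>dim_col A = dim_row K\<close> \<open>dim_col B = b\<close> Kc Measure_A.prems
        by (simp add: mult_mat_assoc)
      also have "B * N * transpose_mat K = B * (N * transpose_mat K)"
        using \<open>dim_col B = b\<close> Kc Measure_A.prems by (simp add: mult_mat_assoc)
      finally show "mat_scaled_entropy \<alpha> (gram (B * N * transpose_mat (A * K)))
          = mat_scaled_entropy \<alpha> (gram (B * (N * transpose_mat K) * transpose_mat A))" by simp
    qed
    also have "\<dots> \<le> mat_scaled_entropy \<alpha> (gram (N * transpose_mat K))" by (rule Measure_A(3)[OF KP NK])
    finally show "(\<Sum>(A, B)\<leftarrow>branches (dim_row K) b P. mat_scaled_entropy \<alpha> (gram (B * N * transpose_mat (A * K))))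
      \<le> mat_scaled_entropy \<alpha> (gram (N * transpose_mat K))" .
  qed
  also have "\<dots> = (\<Sum>K\<leftarrow>map fst Ks. mat_scaled_entropy \<alpha> (gram (N * transpose_mat K)))"
    by (simp add: case_prod_unfold comp_def)
  also have "\<dots> \<le> mat_scaled_entropy \<alpha> (gram N)" by (rule measure_A_step[OF \<alpha> Measure_A(1) Measure_A.prems])
  finally show ?case .
next
  case (Measure_B b Ks a)
  have "(\<Sum>(A, B)\<leftarrow>branches a b (Measure_B Ks). mat_scaled_entropy \<alpha> (gram (B * N * transpose_mat A)))
      = (\<Sum>(K, P)\<leftarrow>Ks. \<Sum>(A, B)\<leftarrow>branches a (dim_row K) P. mat_scaled_entropy \<alpha> (gram (B * K * N * transpose_mat A)))"
    by (simp add: sum_list_concat_map case_prod_unfold comp_def)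
  also have "\<dots> \<le> (\<Sum>(K, P)\<leftarrow>Ks. mat_scaled_entropy \<alpha> (gram (K * N)))"
  proof (intro sum_list_mono, clarify)
    fix K P assume KP: "(K, P) \<in> set Ks"
    then have "K \<in> set (map fst Ks)" by force
    then obtain r where Kc: "K \<in> carrier_mat r b" by (rule kraus_family_carrier[OF Measure_B(1)])
    have NK: "K * N \<in> carrier_mat (dim_row K) a" using Kc Measure_B.prems by simp
    have "(\<Sum>(A, B)\<leftarrow>branches a (dim_row K) P. mat_scaled_entropy \<alpha> (gram (B * K * N * transpose_mat A)))
        = (\<Sum>(A, B)\<leftarrow>branches a (dim_row K) P. mat_scaled_entropy \<alpha> (gram (B * (K * N) * transpose_mat A)))"
    proof (intro arg_cong[of _ _ sum_list] map_cong refl, clarify)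
      fix A B assume "(A, B) \<in> set (branches a (dim_row K) P)"
      then have "dim_col B = dim_row K" using branches_dim_col[OF Measure_B(2)[OF KP]] by auto
      show "mat_scaled_entropy \<alpha> (gram (B * K * N * transpose_mat A)) = mat_scaled_entropy \<alpha> (gram (B * (K * N) * transpose_mat A))"
        using \<open>dim_col B = dim_row K\<close> Kc Measure_B.prems by (simp add: mult_mat_assoc)
    qed
    also have "\<dots> \<le> mat_scaled_entropy \<alpha> (gram (K * N))" by (rule Measure_B(3)[OF KP NK])
    finally show "(\<Sum>(A, B)\<leftarrow>branches a (dim_row K) P. mat_scaled_entropy \<alpha> (gram (B * K * N * transpose_mat A)))
      \<le> mat_scaled_entropy \<alpha> (gram (K * N))" .
  qed
  also have "\<dots> = (\<Sum>K\<leftarrow>map fst Ks. mat_scaled_entropy \<alpha> (gram (K * N)))"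
    by (simp add: case_prod_unfold comp_def)
  also have "\<dots> \<le> mat_scaled_entropy \<alpha> (gram N)" by (rule measure_B_step[OF \<alpha> Measure_B(1) Measure_B.prems])
  finally show ?case .
qed

section \<open>Entanglement entropy of the outcomes\<close>

text \<open>B indexes the rows, so that \<open>gram\<close> gives the reduced state of B without a
  transpose or conjugate.\<close>

definition coeff_mat :: "nat \<Rightarrow> nat \<Rightarrow> complex vec \<Rightarrow> complex mat" where
  "coeff_mat a b \<psi> = mat b a (\<lambda>(j, i). \<psi> $ (i * b + j))"

lemma coeff_mat_carrier [simp]: "coeff_mat a b \<psi> \<in> carrier_mat b a"
  by (simp add: coeff_mat_def)

lemma pair_index_less:
  assumes "i < a" "j < b"
  shows "i * b + j < a * (b :: nat)"
proof -
  have "i * b + j < Suc i * b" using assms by simp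
  also have "\<dots> \<le> a * b" using assms by (intro mult_le_mono1 Suc_leI)
  finally show ?thesis .
qed

lemma sum_pair_index: "(\<Sum>c<a * b. f c) = (\<Sum>i<a. \<Sum>j<b. f (i * b + j))" for b :: nat
proof -
  have "(\<Sum>c<a * b. f c) = (\<Sum>i<a. \<Sum>c\<in>{i * b..<i * b + b}. f c)"
    by (rule sum.nat_group[symmetric])
  also have "\<dots> = (\<Sum>i<a. \<Sum>j<b. f (i * b + j))"
  proof (rule sum.cong[OF refl])
    fix i
    show "(\<Sum>c\<in>{i * b..<i * b + b}. f c) = (\<Sum>j<b. f (i * b + j))"
      by (rule sum.reindex_bij_witness[of _ "\<lambda>j. i * b + j" "\<lambda>c. c - i * b"]) auto
  qed
  finally show ?thesis .
qed

lemma reduced_B_gram: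
  assumes "\<psi> \<in> carrier_vec (a * b)"
  shows "reduced_B a b \<psi> = gram (coeff_mat a b \<psi>)"
proof (intro eq_matI)
  fix j l assume "j < dim_row (gram (coeff_mat a b \<psi>))" "l < dim_col (gram (coeff_mat a b \<psi>))"
  then have jl: "j < b" "l < b" by (auto simp: coeff_mat_def)
  have "reduced_B a b \<psi> $$ (j, l) = (\<Sum>i<a. \<psi> $ (i * b + j) * cnj (\<psi> $ (i * b + l)))"
    using jl assms by (auto simp: reduced_B_def partial_trace_A_def projector_def pair_index_less intro!: sum.cong)
  also have "\<dots> = gram (coeff_mat a b \<psi>) $$ (j, l)"
    using jl by (subst index_mult_sum) (auto simp: coeff_mat_def)
  finally show "reduced_B a b \<psi> $$ (j, l) = gram (coeff_mat a b \<psi>) $$ (j, l)" .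
qed (auto simp: reduced_B_def partial_trace_A_def coeff_mat_def)

text \<open>The vectorisation identity for Kronecker products. Amplitudes transform without
  conjugation, hence a transpose and not an adjoint.\<close>

lemma coeff_mat_kron:
  assumes "dim_col A = a" "dim_col B = b" and \<psi>: "\<psi> \<in> carrier_vec (a * b)"
  shows "coeff_mat (dim_row A) (dim_row B) (kron A B *\<^sub>v \<psi>) = B * coeff_mat a b \<psi> * transpose_mat A"
proof (intro eq_matI)
  fix j i assume "j < dim_row (B * coeff_mat a b \<psi> * transpose_mat A)"
    "i < dim_col (B * coeff_mat a b \<psi> * transpose_mat A)"
  then have ij: "j < dim_row B" "i < dim_row A" by auto
  have "coeff_mat (dim_row A) (dim_row B) (kron A B *\<^sub>v \<psi>) $$ (j, i)
      = (\<Sum>c<a * b. kron A B $$ (i * dim_row B + j, c) * \<psi> $ c)"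
    using ij assms pair_index_less[OF ij(2,1)]
    by (simp add: coeff_mat_def kron_def scalar_prod_def lessThan_atLeast0)
  also have "\<dots> = (\<Sum>k<a. \<Sum>l<b. A $$ (i, k) * B $$ (j, l) * \<psi> $ (k * b + l))"
    unfolding sum_pair_index
    using ij assms pair_index_less[OF ij(2,1)] by (intro sum.cong refl) (simp add: kron_def pair_index_less)
  also have "\<dots> = (\<Sum>k<a. (\<Sum>l<b. B $$ (j, l) * coeff_mat a b \<psi> $$ (l, k)) * A $$ (i, k))"
    by (intro sum.cong refl) (simp add: coeff_mat_def sum_distrib_left sum_distrib_right mult_ac)
  also have "\<dots> = (B * coeff_mat a b \<psi> * transpose_mat A) $$ (j, i)"
    using ij assms by (simp add: index_mult_sum coeff_mat_def del: index_mult_mat(1) assoc_mult_mat)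
  finally show "coeff_mat (dim_row A) (dim_row B) (kron A B *\<^sub>v \<psi>) $$ (j, i)
      = (B * coeff_mat a b \<psi> * transpose_mat A) $$ (j, i)" .
qed (auto simp: coeff_mat_def)

lemma norm_eq_sum_rowsq:
  assumes "\<psi> \<in> carrier_vec (a * b)"
  shows "\<psi> \<bullet>c \<psi> = complex_of_real (\<Sum>j<b. rowsq (coeff_mat a b \<psi>) j)"
proof -
  have "\<psi> \<bullet>c \<psi> = (\<Sum>c<a * b. \<psi> $ c * cnj (\<psi> $ c))"
    using assms by (simp add: scalar_prod_def lessThan_atLeast0)
  also have "\<dots> = (\<Sum>i<a. \<Sum>j<b. complex_of_real ((cmod (\<psi> $ (i * b + j)))\<^sup>2))"
    by (simp add: sum_pair_index complex_norm_square del: of_real_power)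
  also have "\<dots> = (\<Sum>j<b. \<Sum>i<a. complex_of_real ((cmod (\<psi> $ (i * b + j)))\<^sup>2))"
    by (rule sum.swap)
  also have "\<dots> = complex_of_real (\<Sum>j<b. rowsq (coeff_mat a b \<psi>) j)"
    unfolding of_real_sum by (intro sum.cong refl) (simp add: rowsq_def coeff_mat_def)
  finally show ?thesis .
qed

text \<open>The trace of the reduced state is evaluated twice, as the sum of the eigenvalues and as
  the squared norm of the state.\<close>

lemma reduced_B_diagonalisation:
  assumes \<psi>: "\<psi> \<in> carrier_vec (a * b)"
  obtains U d where "unitary_mat b U" "reduced_B a b \<psi> = U * real_diag b d * mat_adjoint U"
    "\<And>k. k < b \<Longrightarrow> 0 \<le> d k" "\<psi> \<bullet>c \<psi> = complex_of_real (\<Sum>k<b. d k)"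
proof -
  define N where "N = coeff_mat a b \<psi>"
  have N: "N \<in> carrier_mat b a" by (simp add: N_def)
  obtain U d where U: "unitary_mat b U" and d: "gram N = U * real_diag b d * mat_adjoint U"
    and d0: "\<And>k. k < b \<Longrightarrow> d k = rowsq (mat_adjoint U * N) k"
    using gram_diagonalisation[OF N] by blast
  have "complex_of_real (\<Sum>k<b. d k) = mat_trace (gram N)"
    unfolding d using trace_conj_diag[OF U] by simp
  also have "\<dots> = (\<Sum>k<b. complex_of_real (rowsq N k))"
    unfolding mat_trace_def using N gram_diag[of _ N] by (intro sum.cong) auto
  also have "\<dots> = \<psi> \<bullet>c \<psi>" using norm_eq_sum_rowsq[OF \<psi>] by (simp add: N_def)
  finally have "\<psi> \<bullet>c \<psi> = complex_of_real (\<Sum>k<b. d k)" by simp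
  moreover have "reduced_B a b \<psi> = U * real_diag b d * mat_adjoint U"
    using reduced_B_gram[OF \<psi>] d by (simp add: N_def)
  ultimately show ?thesis using that U d0 by auto
qed

section \<open>Renyi entropies of spectra\<close>

definition renyi_vec :: "real \<Rightarrow> nat \<Rightarrow> (nat \<Rightarrow> real) \<Rightarrow> real" where
  "renyi_vec \<alpha> n d = (if \<alpha> = 1 then - (\<Sum>i<n. d i * ln (d i))
     else 1 / (1 - \<alpha>) * ln (\<Sum>i<n. d i powr \<alpha>))"

lemma renyi_entropy_eq:
  assumes U: "unitary_mat b U" and d: "reduced_B a b \<psi> = U * real_diag b d * mat_adjoint U"
  shows "renyi_entropy \<alpha> a b \<psi> = renyi_vec \<alpha> b d"
proof -
  have Uc: "U \<in> carrier_mat b b" using U by (simp add: unitary_mat_def)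
  have "reduced_B a b \<psi> * herm_fun ln (reduced_B a b \<psi>)
      = U * real_diag b d * mat_adjoint U * (U * real_diag b (\<lambda>i. ln (d i)) * mat_adjoint U)"
    using herm_fun_eq[OF U d, of ln] d by simp
  also have "\<dots> = U * (real_diag b d * real_diag b (\<lambda>i. ln (d i))) * mat_adjoint U"
    using Uc by (simp add: mult_mat_assoc unitary_mat_cancel[OF U])
  also have "real_diag b d * real_diag b (\<lambda>i. ln (d i)) = real_diag b (\<lambda>i. d i * ln (d i))"
    by (simp add: real_diag_def)
  finally have e: "reduced_B a b \<psi> * herm_fun ln (reduced_B a b \<psi>)
      = U * real_diag b (\<lambda>i. d i * ln (d i)) * mat_adjoint U" .
  show ?thesis
  proof (cases "\<alpha> = 1")
    case True
    then show ?thesis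
      unfolding renyi_entropy_def renyi_vec_def e trace_conj_diag[OF U] by simp
  next
    case False
    then show ?thesis
      unfolding renyi_entropy_def renyi_vec_def herm_fun_eq[OF U d] trace_conj_diag[OF U] by simp
  qed
qed

lemma sum_powr_pos:
  fixes d :: "nat \<Rightarrow> real"
  assumes "\<And>i. i < n \<Longrightarrow> 0 \<le> d i" "(\<Sum>i<n. d i) = 1"
  shows "0 < (\<Sum>i<n. d i powr \<alpha>)"
proof (rule ccontr)
  assume "\<not> 0 < (\<Sum>i<n. d i powr \<alpha>)"
  moreover have "0 \<le> (\<Sum>i<n. d i powr \<alpha>)" by (intro sum_nonneg) simp
  ultimately have "(\<Sum>i<n. d i powr \<alpha>) = 0" by simp
  then have "\<forall>i\<in>{..<n}. d i powr \<alpha> = 0" by (subst (asm) sum_nonneg_eq_0_iff) auto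
  then have "(\<Sum>i<n. d i) = 0" by (intro sum.neutral) simp
  then show False using assms(2) by simp
qed

text \<open>With weights d, the Renyi entropy of order \<open>t + 1\<close> is minus the logarithm of the power mean
  of exponent t of the values d, so this is the monotonicity of power means.\<close>

lemma renyi_vec_antimono:
  assumes d: "\<And>i. i < n \<Longrightarrow> 0 \<le> d i" and d1: "(\<Sum>i<n. d i) = 1"
    and \<alpha>: "0 < \<alpha>" "\<alpha> \<le> \<gamma>"
  shows "renyi_vec \<gamma> n d \<le> renyi_vec \<alpha> n d"
proof -
  define M where "M t = (\<Sum>i<n. d i * d i powr t)" for t
  define G where "G = (\<Sum>i<n. d i * ln (d i))"
  have M: "(\<Sum>i<n. d i powr \<beta>) = M (\<beta> - 1)" for \<beta>
    unfolding M_def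
  proof (intro sum.cong refl)
    fix i assume "i \<in> {..<n}"
    then show "d i powr \<beta> = d i * d i powr (\<beta> - 1)"
      using d[of i] powr_add[of "d i" 1 "\<beta> - 1"] by simp
  qed
  have Mpos: "M t > 0" for t using sum_powr_pos[OF d d1, of "t + 1"] M[of "t + 1"] by simp
  \<comment> \<open>\<open>exp G\<close> is the geometric mean, the power mean of exponent 0. The
    comparison is \<open>ln x \<le> x - 1\<close> at \<open>x = d i powr t / M t\<close>, averaged
    with the weights \<open>d i\<close>.\<close>
  have mean0: "t * G \<le> ln (M t)" for t
  proof -
    have "t * G - ln (M t) = (\<Sum>i<n. t * (d i * ln (d i)) - d i * ln (M t))"
      unfolding sum_subtractf sum_distrib_right[symmetric] d1 G_def sum_distrib_left by simp
    also have "\<dots> \<le> (\<Sum>i<n. d i * d i powr t / M t - d i)"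
    proof (intro sum_mono)
      fix i assume i: "i \<in> {..<n}"
      show "t * (d i * ln (d i)) - d i * ln (M t) \<le> d i * d i powr t / M t - d i"
      proof (cases "d i = 0")
        case False
        then have di: "d i > 0" using d[of i] i by simp
        have "d i * ln (d i powr t / M t) \<le> d i * (d i powr t / M t - 1)"
          using di Mpos[of t] by (intro mult_left_mono ln_le_minus_one) auto
        then show ?thesis using di Mpos[of t] by (simp add: ln_div ln_powr algebra_simps)
      qed simp
    qed
    also have "\<dots> = 0"
      using Mpos[of t] unfolding sum_subtractf d1 sum_divide_distrib[symmetric] M_def[symmetric] by simp
    finally show ?thesis by simp
  qed
  have jensen: "(\<Sum>i<n. d i * entropy_kernel (u / t) (d i powr t)) \<le> entropy_kernel (u / t) (M t)" if "0 < u / t" for t u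
    unfolding M_def using that d d1 by (intro entropy_kernel_jensen) auto
  have Mu: "(\<Sum>i<n. d i * (d i powr t) powr (u / t)) = M u" if "t \<noteq> 0" for t u
    unfolding M_def using that by (simp add: powr_powr)
  have R: "renyi_vec \<beta> n d = - ln (M (\<beta> - 1)) / (\<beta> - 1)" if "\<beta> \<noteq> 1" for \<beta>
    using that by (simp add: renyi_vec_def M divide_simps) (simp add: algebra_simps)
  have R1: "renyi_vec 1 n d = - G" by (simp add: renyi_vec_def G_def)
  have above: "renyi_vec \<beta> n d \<le> - G" if "\<beta> > 1" for \<beta>
    using mean0[of "\<beta> - 1"] that by (simp add: R field_simps)
  have below: "- G \<le> renyi_vec \<beta> n d" if "\<beta> < 1" for \<beta>
    using mean0[of "\<beta> - 1"] that by (simp add: R field_simps)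
  \<comment> \<open>Orders on different sides of 1 are compared through the Shannon entropy
    \<open>- G\<close>; on the same side Jensen is used with the ratio of the exponents.\<close>
  consider "\<alpha> = \<gamma>" | "\<alpha> \<le> 1" "1 \<le> \<gamma>" | "1 < \<alpha>" "\<alpha> < \<gamma>" | "\<gamma> < 1" "\<alpha> < \<gamma>"
    using \<alpha> by linarith
  then show ?thesis
  proof cases
    case 1
    then show ?thesis by simp
  next
    case 2
    then show ?thesis using above[of \<gamma>] below[of \<alpha>] R1
      by (cases "\<alpha> = 1"; cases "\<gamma> = 1") auto
  next
    case 3
    define t u where "t = \<alpha> - 1" and "u = \<gamma> - 1"
    have tu: "0 < t" "t < u" using 3 by (auto simp: t_def u_def)
    then have ut: "u / t > 1" by simp
    have "M t powr (u / t) \<le> M u"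
      using jensen[of u t] ut tu Mu[of t u] by (simp add: entropy_kernel_def sum_negf)
    then have "ln (M t powr (u / t)) \<le> ln (M u)" using Mpos[of t] Mpos[of u] by (intro ln_le_cancel_iff[THEN iffD2]) auto
    then have "u / t * ln (M t) \<le> ln (M u)" using Mpos[of t] by (simp add: ln_powr)
    then show ?thesis using tu 3 by (simp add: R t_def[symmetric] u_def[symmetric] field_simps)
  next
    case 4
    define t u where "t = \<alpha> - 1" and "u = \<gamma> - 1"
    have tu: "u < 0" "t < u" using 4 by (auto simp: t_def u_def)
    \<comment> \<open>Both exponents are negative here, so their ratio is below 1 and the unsigned,
      concave power appears in the kernel.\<close>
    then have ut: "u / t < 1" "0 < u / t" by (auto simp: divide_simps)
    have "M u \<le> M t powr (u / t)"
      using jensen[of u t] ut tu Mu[of t u] by (simp add: entropy_kernel_def)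
    then have "ln (M u) \<le> ln (M t powr (u / t))" using Mpos[of t] Mpos[of u] by (intro ln_le_cancel_iff[THEN iffD2]) auto
    then have "ln (M u) \<le> u / t * ln (M t)" using Mpos[of t] by (simp add: ln_powr)
    then show ?thesis using tu 4 by (simp add: R t_def[symmetric] u_def[symmetric] field_simps)
  qed
qed

lemma renyi_entropy_antimono:
  assumes "0 < \<alpha>" "\<alpha> \<le> \<gamma>" "\<psi> \<in> carrier_vec (a * b)" "\<psi> \<bullet>c \<psi> = 1"
  shows "renyi_entropy \<gamma> a b \<psi> \<le> renyi_entropy \<alpha> a b \<psi>"
proof -
  obtain U d where U: "unitary_mat b U" "reduced_B a b \<psi> = U * real_diag b d * mat_adjoint U"
    and d: "\<And>k. k < b \<Longrightarrow> 0 \<le> d k" "\<psi> \<bullet>c \<psi> = complex_of_real (\<Sum>k<b. d k)"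
    using reduced_B_diagonalisation[OF assms(3)] by blast
  have "(\<Sum>k<b. d k) = 1" using d(2) assms(4) by (metis of_real_eq_1_iff)
  then show ?thesis
    unfolding renyi_entropy_eq[OF U] using assms d(1) by (intro renyi_vec_antimono) auto
qed

text \<open>On unit states the total mass is 1, so its logarithm vanishes at order 1; at other
  orders the root \<open>1 / \<alpha>\<close> is \<open>(1 - \<alpha>) / \<alpha>\<close> times the
  prefactor of the entropy.\<close>

lemma mat_scaled_entropy_renyi_entropy:
  assumes "0 < \<alpha>" "\<psi> \<in> carrier_vec (a * b)" "\<psi> \<bullet>c \<psi> = 1"
  shows "mat_scaled_entropy \<alpha> (reduced_B a b \<psi>) = (if \<alpha> = 1 then renyi_entropy 1 a b \<psi>
    else sgn (1 - \<alpha>) * exp ((1 - \<alpha>) / \<alpha> * renyi_entropy \<alpha> a b \<psi>))"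
proof -
  obtain U d where U: "unitary_mat b U" "reduced_B a b \<psi> = U * real_diag b d * mat_adjoint U"
    and d: "\<And>k. k < b \<Longrightarrow> 0 \<le> d k" "\<psi> \<bullet>c \<psi> = complex_of_real (\<Sum>k<b. d k)"
    using reduced_B_diagonalisation[OF assms(2)] by blast
  have d1: "(\<Sum>k<b. d k) = 1" using d(2) assms(3) by (metis of_real_eq_1_iff)
  show ?thesis
  proof (cases "\<alpha> = 1")
    case True
    then show ?thesis
      by (simp add: mat_scaled_entropy_eq[OF U] renyi_entropy_eq[OF U] scaled_entropy_def renyi_vec_def d1 sum_negf)
  next
    case False
    have "(\<Sum>i<b. d i powr \<alpha>) powr (1 / \<alpha>) = exp ((1 - \<alpha>) / \<alpha> * renyi_vec \<alpha> b d)"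
      using False sum_powr_pos[OF d(1) d1, of \<alpha>] by (simp add: powr_def renyi_vec_def)
    then show ?thesis
      using False by (simp add: mat_scaled_entropy_eq[OF U] renyi_entropy_eq[OF U] scaled_entropy_def)
  qed
qed

text \<open>At order 1 the two terms with \<open>ln c\<close>, one from the entropy and one from the
  logarithm of the mass, cancel.\<close>

lemma scaled_entropy_scale:
  assumes "0 < \<alpha>" "0 < c" and x: "\<And>i. i < n \<Longrightarrow> 0 \<le> x i"
  shows "scaled_entropy \<alpha> n (\<lambda>i. c * x i) = c * scaled_entropy \<alpha> n x"
proof (cases "\<alpha> = 1")
  case True
  have "c * x i * ln (c * x i) = c * (x i * ln (x i)) + c * ln c * x i" if "i < n" for i
    using x[OF that] assms(2) by (cases "x i = 0") (auto simp: ln_mult algebra_simps)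
  then have "(\<Sum>i<n. c * x i * ln (c * x i)) = (\<Sum>i<n. c * (x i * ln (x i)) + c * ln c * x i)"
    by (intro sum.cong) auto
  also have "\<dots> = c * (\<Sum>i<n. x i * ln (x i)) + c * ln c * (\<Sum>i<n. x i)"
    by (simp add: sum.distrib sum_distrib_left)
  finally have e: "(\<Sum>i<n. c * x i * ln (c * x i)) = c * (\<Sum>i<n. x i * ln (x i)) + c * ln c * (\<Sum>i<n. x i)" .
  have T: "(\<Sum>i<n. c * x i) * ln (\<Sum>i<n. c * x i)
      = c * ((\<Sum>i<n. x i) * ln (\<Sum>i<n. x i)) + c * ln c * (\<Sum>i<n. x i)"
    unfolding sum_distrib_left[symmetric]
    using assms(2) sum_nonneg[of "{..<n}" x] x
    by (cases "(\<Sum>i<n. x i) = 0") (auto simp: ln_mult algebra_simps)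
  show ?thesis using True e T by (simp add: scaled_entropy_def sum_negf algebra_simps)
next
  case False
  have "(\<Sum>i<n. (c * x i) powr \<alpha>) = c powr \<alpha> * (\<Sum>i<n. x i powr \<alpha>)"
    using x assms(2) by (simp add: powr_mult sum_distrib_left)
  then have "(\<Sum>i<n. (c * x i) powr \<alpha>) powr (1 / \<alpha>) = c * (\<Sum>i<n. x i powr \<alpha>) powr (1 / \<alpha>)"
    using assms by (simp add: powr_mult powr_powr sum_nonneg)
  then show ?thesis using False by (simp add: scaled_entropy_def)
qed

lemma mat_scaled_entropy_zero_state:
  assumes "\<psi> \<in> carrier_vec (a * b)" "\<psi> \<bullet>c \<psi> = 0"
  shows "mat_scaled_entropy \<alpha> (reduced_B a b \<psi>) = 0"
proof -
  obtain U d where U: "unitary_mat b U" "reduced_B a b \<psi> = U * real_diag b d * mat_adjoint U"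
    and d: "\<And>k. k < b \<Longrightarrow> 0 \<le> d k" "\<psi> \<bullet>c \<psi> = complex_of_real (\<Sum>k<b. d k)"
    using reduced_B_diagonalisation[OF assms(1)] by blast
  have "(\<Sum>k<b. d k) = 0" using d(2) assms(2) by (metis of_real_eq_0_iff)
  then have "\<forall>k\<in>{..<b}. d k = 0" using d(1) by (subst (asm) sum_nonneg_eq_0_iff) auto
  then show ?thesis using mat_scaled_entropy_eq[OF U] scaled_entropy_zero by simp
qed

lemma mat_scaled_entropy_scaled_state:
  assumes \<alpha>: "0 < \<alpha>" and \<psi>: "\<psi> \<in> carrier_vec (a * b)" and c: "0 < c"
  shows "mat_scaled_entropy \<alpha> (reduced_B a b (complex_of_real c \<cdot>\<^sub>v \<psi>)) = c\<^sup>2 * mat_scaled_entropy \<alpha> (reduced_B a b \<psi>)"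
proof -
  obtain U d where U: "unitary_mat b U" and d: "reduced_B a b \<psi> = U * real_diag b d * mat_adjoint U"
    and d0: "\<And>k. k < b \<Longrightarrow> 0 \<le> d k"
    using reduced_B_diagonalisation[OF \<psi>] by blast
  have Uc: "U \<in> carrier_mat b b" using U by (simp add: unitary_mat_def)
  let ?z = "complex_of_real (c\<^sup>2)"
  have "reduced_B a b (complex_of_real c \<cdot>\<^sub>v \<psi>) = ?z \<cdot>\<^sub>m reduced_B a b \<psi>"
    using \<psi> by (intro eq_matI)
      (auto simp: reduced_B_def partial_trace_A_def projector_def pair_index_less
        sum_distrib_left power2_eq_square intro!: sum.cong)
  also have "\<dots> = U * (?z \<cdot>\<^sub>m real_diag b d) * mat_adjoint U"
    unfolding d using Uc
    by (simp add: mult_smult_distrib[of _ b b _ b] mult_smult_assoc_mat[of _ b b _ b] mult_mat_assoc)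
  also have "?z \<cdot>\<^sub>m real_diag b d = real_diag b (\<lambda>i. c\<^sup>2 * d i)"
    by (intro eq_matI) auto
  finally have "mat_scaled_entropy \<alpha> (reduced_B a b (complex_of_real c \<cdot>\<^sub>v \<psi>)) = scaled_entropy \<alpha> b (\<lambda>i. c\<^sup>2 * d i)"
    using mat_scaled_entropy_eq[OF U] by simp
  then show ?thesis using scaled_entropy_scale[OF \<alpha>, of "c\<^sup>2" b d] c d0 mat_scaled_entropy_eq[OF U d] by simp
qed

section \<open>Outcomes with their probabilities\<close>

lemma kron_mult_carrier: "kron A B *\<^sub>v \<psi> \<in> carrier_vec (dim_row A * dim_row B)"
  by (rule carrier_vecI) (simp add: kron_def)

lemma outcome_prob_nonneg: "0 \<le> outcome_prob A B \<psi>"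
  and outcome_prob_eq: "(kron A B *\<^sub>v \<psi>) \<bullet>c (kron A B *\<^sub>v \<psi>) = complex_of_real (outcome_prob A B \<psi>)"
proof -
  note n = norm_eq_sum_rowsq[OF kron_mult_carrier[of A B \<psi>]]
  show "0 \<le> outcome_prob A B \<psi>" by (simp add: outcome_prob_def Let_def n sum_nonneg)
  show "(kron A B *\<^sub>v \<psi>) \<bullet>c (kron A B *\<^sub>v \<psi>) = complex_of_real (outcome_prob A B \<psi>)"
    by (simp add: outcome_prob_def Let_def n)
qed

lemma outcome_state_carrier: "outcome_state A B \<psi> \<in> carrier_vec (dim_row A * dim_row B)"
  unfolding outcome_state_def using kron_mult_carrier by simp

lemma outcome_state_unit:
  assumes "outcome_prob A B \<psi> > 0"
  shows "outcome_state A B \<psi> \<bullet>c outcome_state A B \<psi> = 1"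
proof -
  define p where "p = outcome_prob A B \<psi>"
  define c where "c = 1 / sqrt p"
  define \<phi> where "\<phi> = kron A B *\<^sub>v \<psi>"
  have "outcome_state A B \<psi> \<bullet>c outcome_state A B \<psi> = complex_of_real c * (complex_of_real c * (\<phi> \<bullet>c \<phi>))"
    unfolding outcome_state_def p_def[symmetric] c_def[symmetric] \<phi>_def[symmetric]
    by (simp add: scalar_prod_def sum_distrib_left mult_ac)
  also have "\<dots> = complex_of_real (c * (c * p))"
    unfolding \<phi>_def outcome_prob_eq p_def[symmetric] by simp
  also have "c * (c * p) = 1" using assms by (simp add: c_def p_def)
  finally show ?thesis by simp
qed

text \<open>Homogeneity pulls the normalisation out as the factor \<open>outcome_prob\<close>.
  Discarded outcomes come from null vectors and contribute 0, so branches and listed outcomes give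
  the same sum.\<close>

lemma mat_scaled_entropy_outcome:
  assumes \<alpha>: "0 < \<alpha>"
  shows "mat_scaled_entropy \<alpha> (reduced_B (dim_row A) (dim_row B) (kron A B *\<^sub>v \<psi>)) =
    (if outcome_prob A B \<psi> > 0
     then outcome_prob A B \<psi> * mat_scaled_entropy \<alpha> (reduced_B (dim_row A) (dim_row B) (outcome_state A B \<psi>))
     else 0)"
proof (cases "outcome_prob A B \<psi> > 0")
  case True
  then show ?thesis
    unfolding outcome_state_def
    using mat_scaled_entropy_scaled_state[OF \<alpha> kron_mult_carrier[of A B \<psi>], of "1 / sqrt (outcome_prob A B \<psi>)"]
    by (simp add: power_divide)
next
  case False
  then have "outcome_prob A B \<psi> = 0" using outcome_prob_nonneg[of A B \<psi>] by simp
  then show ?thesis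
    using mat_scaled_entropy_zero_state[OF kron_mult_carrier[of A B \<psi>]] outcome_prob_eq[of A B \<psi>] by simp
qed

lemma outcomes_states:
  assumes "(p, a', b', \<Phi>) \<in> set (outcomes a b P \<Psi>)"
  shows "0 < p" "\<Phi> \<in> carrier_vec (a' * b')" "\<Phi> \<bullet>c \<Phi> = 1"
  using assms by (auto simp: outcomes_def outcome_state_carrier outcome_state_unit)

lemma mat_scaled_entropy_outcomes:
  assumes \<alpha>: "0 < \<alpha>" and \<Psi>: "\<Psi> \<in> carrier_vec (a * b)" and P: "slocc_protocol a b P"
  shows "(\<Sum>(p, a', b', \<Phi>)\<leftarrow>outcomes a b P \<Psi>. p * mat_scaled_entropy \<alpha> (reduced_B a' b' \<Phi>))
    \<le> mat_scaled_entropy \<alpha> (reduced_B a b \<Psi>)"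
proof -
  let ?N = "coeff_mat a b \<Psi>"
  have "(\<Sum>(p, a', b', \<Phi>)\<leftarrow>outcomes a b P \<Psi>. p * mat_scaled_entropy \<alpha> (reduced_B a' b' \<Phi>))
      = (\<Sum>(A, B)\<leftarrow>branches a b P. mat_scaled_entropy \<alpha> (reduced_B (dim_row A) (dim_row B) (kron A B *\<^sub>v \<Psi>)))"
    unfolding mat_scaled_entropy_outcome[OF \<alpha>]
    by (simp add: outcomes_def sum_list_map_filter' comp_def case_prod_unfold)
  also have "\<dots> = (\<Sum>(A, B)\<leftarrow>branches a b P. mat_scaled_entropy \<alpha> (gram (B * ?N * transpose_mat A)))"
  proof (intro arg_cong[of _ _ sum_list] map_cong refl, clarify)
    fix A B assume "(A, B) \<in> set (branches a b P)"
    then have "dim_col A = a" "dim_col B = b" using branches_dim_col[OF P] by auto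
    then show "mat_scaled_entropy \<alpha> (reduced_B (dim_row A) (dim_row B) (kron A B *\<^sub>v \<Psi>))
        = mat_scaled_entropy \<alpha> (gram (B * ?N * transpose_mat A))"
      using reduced_B_gram[OF kron_mult_carrier] coeff_mat_kron \<Psi> by metis
  qed
  also have "\<dots> \<le> mat_scaled_entropy \<alpha> (gram ?N)" by (rule mat_scaled_entropy_branches[OF \<alpha> P]) simp
  finally show ?thesis by (simp only: reduced_B_gram[OF \<Psi>])
qed

text \<open>At order 2 the functional is strictly negative on unit states, while an empty list would
  have sum 0, against the monotonicity just shown.\<close>

lemma outcomes_nonempty:
  assumes \<Psi>: "\<Psi> \<in> carrier_vec (a * b)" "\<Psi> \<bullet>c \<Psi> = 1" and P: "slocc_protocol a b P"
  shows "outcomes a b P \<Psi> \<noteq> []"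
proof
  assume "outcomes a b P \<Psi> = []"
  then have "0 \<le> mat_scaled_entropy 2 (reduced_B a b \<Psi>)" using mat_scaled_entropy_outcomes[OF _ \<Psi>(1) P, of 2] by simp
  moreover have "mat_scaled_entropy 2 (reduced_B a b \<Psi>) < 0"
    using mat_scaled_entropy_renyi_entropy[OF _ \<Psi>, of 2] by simp
  ultimately show False by simp
qed

theorem proposition3:
  fixes \<alpha> \<gamma> :: real and a b :: nat and \<Psi> :: "complex vec" and P :: protocol
  assumes "0 < \<alpha>" and "\<alpha> \<le> \<gamma>"
    and "\<Psi> \<in> carrier_vec (a * b)" and "\<Psi> \<bullet>c \<Psi> = 1"
    and "slocc_protocol a b P"
  shows "renyi_entropy \<alpha> a b \<Psi> \<ge>
    (if \<alpha> = 1
     then (\<Sum>(p, a', b', \<Phi>) \<leftarrow> outcomes a b P \<Psi>. p * renyi_entropy \<gamma> a' b' \<Phi>)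
     else \<alpha> / (1 - \<alpha>) *
       ln (\<Sum>(p, a', b', \<Phi>) \<leftarrow> outcomes a b P \<Psi>.
             p * exp ((1 - \<alpha>) / \<alpha> * renyi_entropy \<gamma> a' b' \<Phi>)))"
proof -
  let ?os = "outcomes a b P \<Psi>" and ?c = "(1 - \<alpha>) / \<alpha>"
  note H = mat_scaled_entropy_renyi_entropy[OF assms(1)]
  note out = outcomes_states[of _ _ _ _ a b P \<Psi>]
  have mono: "renyi_entropy \<gamma> a' b' \<Phi> \<le> renyi_entropy \<alpha> a' b' \<Phi>" if "(p, a', b', \<Phi>) \<in> set ?os" for p a' b' \<Phi>
    using renyi_entropy_antimono[OF assms(1,2)] out(2,3)[OF that] .
  show ?thesis
  proof (cases "\<alpha> = 1")
    case True
    have "(\<Sum>(p, a', b', \<Phi>)\<leftarrow>?os. p * renyi_entropy \<gamma> a' b' \<Phi>)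
        \<le> (\<Sum>(p, a', b', \<Phi>)\<leftarrow>?os. p * mat_scaled_entropy \<alpha> (reduced_B a' b' \<Phi>))"
    proof (intro sum_list_mono, clarify)
      fix p a' b' \<Phi> assume o: "(p, a', b', \<Phi>) \<in> set ?os"
      show "p * renyi_entropy \<gamma> a' b' \<Phi> \<le> p * mat_scaled_entropy \<alpha> (reduced_B a' b' \<Phi>)"
        using out[OF o] mono[OF o] H[of \<Phi> a' b'] True by simp
    qed
    also have "\<dots> \<le> mat_scaled_entropy \<alpha> (reduced_B a b \<Psi>)" by (rule mat_scaled_entropy_outcomes[OF assms(1,3,5)])
    also have "\<dots> = renyi_entropy \<alpha> a b \<Psi>" using H[OF assms(3,4)] True by simp
    finally show ?thesis using True by simp
  next
    case \<alpha>1: False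
    define X where "X = (\<Sum>(p, a', b', \<Phi>)\<leftarrow>?os. p * exp (?c * renyi_entropy \<gamma> a' b' \<Phi>))"
    have "sgn (1 - \<alpha>) * X = (\<Sum>(p, a', b', \<Phi>)\<leftarrow>?os. p * (sgn (1 - \<alpha>) * exp (?c * renyi_entropy \<gamma> a' b' \<Phi>)))"
      unfolding X_def sum_list_const_mult[symmetric] by (simp add: case_prod_unfold mult_ac)
    also have "\<dots> \<le> (\<Sum>(p, a', b', \<Phi>)\<leftarrow>?os. p * mat_scaled_entropy \<alpha> (reduced_B a' b' \<Phi>))"
    proof (intro sum_list_mono, clarify)
      fix p a' b' \<Phi> assume o: "(p, a', b', \<Phi>) \<in> set ?os"
      have "sgn (1 - \<alpha>) * exp (?c * renyi_entropy \<gamma> a' b' \<Phi>)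
          \<le> sgn (1 - \<alpha>) * exp (?c * renyi_entropy \<alpha> a' b' \<Phi>)"
      proof (cases "\<alpha> < 1")
        case True
        then have "?c * renyi_entropy \<gamma> a' b' \<Phi> \<le> ?c * renyi_entropy \<alpha> a' b' \<Phi>"
          using mono[OF o] assms(1) by (intro mult_left_mono) auto
        then show ?thesis using True by simp
      next
        case False
        \<comment> \<open>For \<alpha> > 1 the exponential decreases in the entropy, and the sign of
          \<open>1 - \<alpha>\<close> reverses the inequality once more.\<close>
        then have "?c \<le> 0" using assms(1) \<alpha>1 by (simp add: divide_simps)
        then have "?c * renyi_entropy \<alpha> a' b' \<Phi> \<le> ?c * renyi_entropy \<gamma> a' b' \<Phi>"
          using mono[OF o] by (intro mult_left_mono_neg) auto
        then show ?thesis using False \<alpha>1 by simp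
      qed
      then show "p * (sgn (1 - \<alpha>) * exp (?c * renyi_entropy \<gamma> a' b' \<Phi>)) \<le> p * mat_scaled_entropy \<alpha> (reduced_B a' b' \<Phi>)"
        using out[OF o] H[of \<Phi> a' b'] \<alpha>1 by (simp add: mult_left_mono)
    qed
    also have "\<dots> \<le> mat_scaled_entropy \<alpha> (reduced_B a b \<Psi>)" by (rule mat_scaled_entropy_outcomes[OF assms(1,3,5)])
    also have "\<dots> = sgn (1 - \<alpha>) * exp (?c * renyi_entropy \<alpha> a b \<Psi>)" using H[OF assms(3,4)] \<alpha>1 by simp
    finally have le: "sgn (1 - \<alpha>) * X \<le> sgn (1 - \<alpha>) * exp (?c * renyi_entropy \<alpha> a b \<Psi>)" .
    have cancel: "\<alpha> / (1 - \<alpha>) * (?c * E) = E" for E using assms(1) \<alpha>1 by simp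
    have "\<alpha> / (1 - \<alpha>) * ln X \<le> \<alpha> / (1 - \<alpha>) * (?c * renyi_entropy \<alpha> a b \<Psi>)"
    proof (cases "\<alpha> < 1")
      case True
      \<comment> \<open>For \<alpha> < 1 the functional bounds \<open>X\<close> only from above, so
        positivity has to come from an outcome of positive probability.\<close>
      have "X > 0"
      proof -
        obtain p a' b' \<Phi> os where os: "?os = (p, a', b', \<Phi>) # os"
          using outcomes_nonempty[OF assms(3,4,5)] by (metis list.exhaust prod_cases4)
        have "0 < p" using out(1)[of p a' b' \<Phi>] os by simp
        moreover have "0 \<le> (\<Sum>(p, a', b', \<Phi>)\<leftarrow>os. p * exp (?c * renyi_entropy \<gamma> a' b' \<Phi>))"
        proof (rule sum_list_nonneg)
          fix x assume "x \<in> set (map (\<lambda>(p, a', b', \<Phi>). p * exp (?c * renyi_entropy \<gamma> a' b' \<Phi>)) os)"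
          then obtain q a'' b'' \<Phi>' where q: "(q, a'', b'', \<Phi>') \<in> set os"
            and x: "x = q * exp (?c * renyi_entropy \<gamma> a'' b'' \<Phi>')" by auto
          have "0 < q" using out(1)[of q a'' b'' \<Phi>'] os q by simp
          then show "0 \<le> x" by (simp add: x)
        qed
        ultimately show ?thesis unfolding X_def os by (simp add: add_pos_nonneg)
      qed
      then have "ln X \<le> ?c * renyi_entropy \<alpha> a b \<Psi>"
        using le True by (metis diff_gt_0_iff_gt exp_gt_zero ln_exp ln_le_cancel_iff mult_1 sgn_pos)
      then show ?thesis using True assms(1) by (intro mult_left_mono) auto
    next
      case False
      \<comment> \<open>Here the exponential bounds \<open>X\<close> from below, which also makes
        \<open>X\<close> positive; the negative prefactor turns the inequality around.\<close>
      then have "exp (?c * renyi_entropy \<alpha> a b \<Psi>) \<le> X" using le \<alpha>1 by simp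
      then have "?c * renyi_entropy \<alpha> a b \<Psi> \<le> ln X"
        by (metis exp_gt_zero ln_exp ln_le_cancel_iff order_less_le_trans)
      then show ?thesis using False \<alpha>1 assms(1) by (intro mult_left_mono_neg) (auto simp: divide_simps)
    qed
    then show ?thesis unfolding cancel X_def using \<alpha>1 by simp
  qed
qed

end
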